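(* Let $n\ge0$ and $\Phi\in\mathrm{End}(\mathcal{Q})$. Suppose that the numbers $c_{\alpha,(n)}$, $\alpha\in\operatorname{Comp}(n)$, are nonnegative and not all zero, and that $c_{\alpha,(n)}>0$ for some $\alpha\in\operatorname{Comp}(n)\setminus\{(n),(1^n)\}$. Then $K$ has a unique stationary distribution, namely the uniform distribution on $\mathfrak{S}_n$, and $\overline{K}$ has a unique stationary distribution, namely the distribution of descent compositions of a uniformly random permutation, $\alpha\mapsto \#\{\sigma\in\mathfrak{S}_n: D(\sigma)=\alpha\}/n!$.
   Context: Work over $\mathbb{Q}$. A composition of $n\ge0$ is a sequence $\alpha=(a_1,\dots,a_k)$ of positive integers with sum $n$; $\operatorname{Comp}(n)$ is the set of them, $(n)$ is the one-part composition and $(1^n)$ the composition with $n$ parts equal to $1$. Put $S_\alpha=\{a_1,\dots,a_1+\dots+a_{k-1}\}\subseteq[n-1]$, with inverse bijection $S\mapsto\operatorname{co}(S)$. Order $\operatorname{Comp}(n)$ by $\alpha\le\beta$ iff $S_\alpha\subseteq S_\beta$. $M_\alpha=\sum_{i_1<\dots<i_k}x_{i_1}^{a_1}\cdots x_{i_k}^{a_k}$; $\mathcal{Q}_n=\operatorname{span}\{M_\alpha\}_{\alpha\in\operatorname{Comp}(n)}$; $\mathcal{Q}=\bigoplus_n\mathcal{Q}_n$ is the graded Hopf algebra of quasisymmetric functions (product of power series, coproduct $\Delta(M_\alpha)=\sum_{\alpha=\beta\cdot\gamma}M_\beta\otimes M_\gamma$ over deconcatenations). $F_\alpha=\sum_{\beta\ge\alpha}M_\beta$.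 $\mathrm{End}(\mathcal{Q})$ is the set of graded Hopf algebra endomorphisms of $\mathcal{Q}$. For $\sigma\in\mathfrak{S}_n$ in one-line notation, $D(\sigma)=\operatorname{co}(\{i:\sigma_i>\sigma_{i+1}\})$; the product in $\mathfrak{S}_n$ is composition. Define $c_{\alpha,\beta}$ by $\Phi(F_\alpha)=\sum_\beta c_{\alpha,\beta}F_\beta$, $\lambda$ by $\Phi(M_{(1)})=\lambda M_{(1)}$, $\mathrm{Prob}_\Phi(\pi)=c_{D(\pi),(n)}/\sum_{\sigma}c_{D(\sigma),(n)}$, the matrix $K(\pi,\sigma\pi)=\mathrm{Prob}_\Phi(\sigma^{-1})$ on $\mathfrak{S}_n$, and $\overline{K}(\alpha,\beta)=c_{\alpha,\beta}/\lambda^n$ on $\operatorname{Comp}(n)$ (under the hypotheses $\lambda^n>0$ and both are stochastic matrices). A stationary distribution of a stochastic matrix $P$ is a probability row vector $\mu$ with $\mu P=\mu$. *)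

theory Defs
  imports
    Complex_Main
    "HOL-Library.Poly_Mapping"
    "HOL-Combinatorics.Permutations"
begin

section \<open>Power series over the rationals in countably many variables\<close>

text \<open>The variables are \<open>x\<^sub>0, x\<^sub>1, x\<^sub>2, \<dots>\<close>; a monomial is its finitely supported exponent
  function, so that the product of monomials is the sum of exponents.\<close>

type_synonym monom = "nat \<Rightarrow>\<^sub>0 nat"

typedef pseries = "UNIV :: (monom \<Rightarrow> rat) set"
  morphisms coeff Abs_pseries by auto

setup_lifting type_definition_pseries

lemma pseries_eqI: "(\<And>m. coeff f m = coeff g m) \<Longrightarrow> f = g"
  by (metis coeff_inject ext)

definition splits :: "monom \<Rightarrow> (monom \<times> monom) set"
  where "splits m = {(a, b). a + b = m}"

lemma finite_splits: "finite (splits m)"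
proof -
  let ?A = "{a. \<exists>b. a + b = m}"
  have "Poly_Mapping.lookup ` ?A \<subseteq> {f. \<forall>x. (x \<in> Poly_Mapping.keys m \<longrightarrow> f x \<in> {..Max (range (Poly_Mapping.lookup m))}) \<and>
                           (x \<notin> Poly_Mapping.keys m \<longrightarrow> f x = 0)}"
  proof clarify
    fix x and a b :: monom assume m: "m = a + b"
    have fin: "finite (range (Poly_Mapping.lookup (a + b)))"
      by (rule finite_subset[of _ "insert 0 (Poly_Mapping.lookup (a + b) ` Poly_Mapping.keys (a + b))"])
         (auto simp: in_keys_iff)
    have "Poly_Mapping.lookup a x \<le> Poly_Mapping.lookup (a + b) x" by (simp add: lookup_add)
    moreover have "Poly_Mapping.lookup (a + b) x \<le> Max (range (Poly_Mapping.lookup (a + b)))"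
      using fin by (intro Max_ge) auto
    ultimately show "(x \<in> Poly_Mapping.keys (a + b) \<longrightarrow> Poly_Mapping.lookup a x \<in> {..Max (range (Poly_Mapping.lookup (a + b)))}) \<and>
        (x \<notin> Poly_Mapping.keys (a + b) \<longrightarrow> Poly_Mapping.lookup a x = 0)"
      by (auto simp: in_keys_iff lookup_add)
  qed
  moreover have "finite {f. \<forall>x. (x \<in> Poly_Mapping.keys m \<longrightarrow> f x \<in> {..Max (range (Poly_Mapping.lookup m))}) \<and>
                           (x \<notin> Poly_Mapping.keys m \<longrightarrow> f x = 0)}"
    by (rule finite_set_of_finite_funs) auto
  ultimately have "finite (Poly_Mapping.lookup ` ?A)" by (rule finite_subset)
  then have fA: "finite ?A"
    by (rule finite_imageD) (simp add: inj_on_def poly_mapping.lookup_inject)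
  have "splits m \<subseteq> (\<lambda>a. (a, m - a)) ` ?A" by (auto simp: splits_def)
  with fA show ?thesis by (meson finite_imageI finite_subset)
qed

instantiation pseries :: comm_ring_1
begin

lift_definition zero_pseries :: pseries is "\<lambda>_. 0" .
lift_definition one_pseries :: pseries is "\<lambda>m. if m = 0 then 1 else 0" .
lift_definition plus_pseries :: "pseries \<Rightarrow> pseries \<Rightarrow> pseries" is "\<lambda>f g m. f m + g m" .
lift_definition minus_pseries :: "pseries \<Rightarrow> pseries \<Rightarrow> pseries" is "\<lambda>f g m. f m - g m" .
lift_definition uminus_pseries :: "pseries \<Rightarrow> pseries" is "\<lambda>f m. - f m" .
lift_definition times_pseries :: "pseries \<Rightarrow> pseries \<Rightarrow> pseries"
  is "\<lambda>f g m. \<Sum>(a, b) \<in> splits m. f a * g b" .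

instance
proof
  fix f g h :: pseries
  show "f * g = g * f"
  proof transfer
    fix f g :: "monom \<Rightarrow> rat"
    show "(\<lambda>m. \<Sum>(a, b) \<in> splits m. f a * g b) = (\<lambda>m. \<Sum>(a, b) \<in> splits m. g a * f b)"
      by (intro ext sum.reindex_bij_witness[of _ prod.swap prod.swap])
         (auto simp: splits_def ac_simps)
  qed
  show "f * g * h = f * (g * h)"
  proof transfer
    fix f g h :: "monom \<Rightarrow> rat"
    show "(\<lambda>m. \<Sum>(a, c) \<in> splits m. (\<Sum>(a, b) \<in> splits a. f a * g b) * h c) =
          (\<lambda>m. \<Sum>(a, c) \<in> splits m. f a * (\<Sum>(b, c) \<in> splits c. g b * h c))"
    proof
      fix m
      have "(\<Sum>(a, c) \<in> splits m. (\<Sum>(a, b) \<in> splits a. f a * g b) * h c) =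
            (\<Sum>(p, q) \<in> Sigma (splits m) (\<lambda>p. splits (fst p)). f (fst q) * g (snd q) * h (snd p))"
        by (subst sum.Sigma[symmetric])
           (auto simp: finite_splits sum_distrib_right split_def intro!: sum.cong)
      also have "\<dots> = (\<Sum>(p, q) \<in> Sigma (splits m) (\<lambda>p. splits (snd p)).
                         f (fst p) * (g (fst q) * h (snd q)))"
        by (rule sum.reindex_bij_witness
              [of _ "\<lambda>(p, q). ((fst p + fst q, snd q), (fst p, fst q))"
                    "\<lambda>(p, q). ((fst q, snd q + snd p), (snd q, snd p))"])
           (auto simp: splits_def ac_simps)
      also have "\<dots> = (\<Sum>(a, c) \<in> splits m. f a * (\<Sum>(b, c) \<in> splits c. g b * h c))"
        by (subst sum.Sigma[symmetric])
           (auto simp: finite_splits sum_distrib_left split_def intro!: sum.cong)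
      finally show "(\<Sum>(a, c) \<in> splits m. (\<Sum>(a, b) \<in> splits a. f a * g b) * h c) =
          (\<Sum>(a, c) \<in> splits m. f a * (\<Sum>(b, c) \<in> splits c. g b * h c))" .
    qed
  qed
  show "1 * f = f"
  proof transfer
    fix f :: "monom \<Rightarrow> rat"
    show "(\<lambda>m. \<Sum>(a, b) \<in> splits m. (if a = 0 then 1 else 0) * f b) = f"
    proof
      fix m
      have "(\<Sum>(a, b) \<in> splits m. (if a = 0 then 1 else 0) * f b) =
            (\<Sum>(a, b) \<in> {(0 :: monom, m)}. (if a = 0 then 1 else 0) * f b)"
        by (rule sum.mono_neutral_right) (use finite_splits[of m] in \<open>auto simp: splits_def split: if_splits\<close>)
      then show "(\<Sum>(a, b) \<in> splits m. (if a = 0 then 1 else 0) * f b) = f m" by simp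
    qed
  qed
  show "(f + g) * h = f * h + g * h"
    by transfer (simp add: split_def distrib_right sum.distrib)
  show "f + g + h = f + (g + h)" by transfer (simp add: ac_simps)
  show "f + g = g + f" by transfer (simp add: ac_simps)
  show "0 + f = f" by transfer simp
  show "- f + f = 0" by transfer simp
  show "f - g = f + - g" by transfer simp
  show "(0::pseries) \<noteq> 1" by transfer (metis zero_neq_one)
qed

end

lift_definition scale :: "rat \<Rightarrow> pseries \<Rightarrow> pseries" is "\<lambda>c f m. c * f m" .

interpretation pseries: vector_space scale
  by standard (transfer; simp add: algebra_simps)+


section \<open>Compositions\<close>

definition compositions :: "nat list set"
  where "compositions = {\<alpha>. \<forall>a \<in> set \<alpha>. 0 < a}"

definition Comp :: "nat \<Rightarrow> nat list set"
  where "Comp n = {\<alpha> \<in> compositions. sum_list \<alpha> = n}"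

text \<open>For \<open>n = 0\<close> the one-part composition degenerates to the empty composition, the only element
  of \<open>Comp 0\<close>.\<close>

definition one_part :: "nat \<Rightarrow> nat list"
  where "one_part n = (if n = 0 then [] else [n])"

definition all_ones :: "nat \<Rightarrow> nat list"
  where "all_ones n = replicate n 1"

definition S_of :: "nat list \<Rightarrow> nat set"
  where "S_of \<alpha> = {sum_list (take i \<alpha>) | i. 1 \<le> i \<and> i < length \<alpha>}"

definition co :: "nat \<Rightarrow> nat set \<Rightarrow> nat list"
  where "co n = inv_into (Comp n) S_of"


section \<open>Quasisymmetric functions\<close>

text \<open>The coefficient of a monomial \<open>m\<close> in \<open>M \<alpha>\<close> is the number of strictly increasing index
  sequences \<open>i\<^sub>1 < \<dots> < i\<^sub>k\<close> whose term in the defining sum is \<open>m\<close>.\<close>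

definition M :: "nat list \<Rightarrow> pseries" where
  "M \<alpha> = Abs_pseries (\<lambda>m. of_nat (card
     {is. length is = length \<alpha> \<and> sorted_wrt (<) is \<and>
          m = (\<Sum>j<length \<alpha>. Poly_Mapping.single (is ! j) (\<alpha> ! j))}))"

definition F :: "nat list \<Rightarrow> pseries" where
  "F \<alpha> = (\<Sum>\<beta> \<in> {\<beta> \<in> Comp (sum_list \<alpha>). S_of \<alpha> \<subseteq> S_of \<beta>}. M \<beta>)"

definition QSym_deg :: "nat \<Rightarrow> pseries set"
  where "QSym_deg n = pseries.span (M ` Comp n)"

definition QSym :: "pseries set"
  where "QSym = pseries.span (M ` compositions)"

definition M_coord :: "pseries \<Rightarrow> nat list \<Rightarrow> rat"
  where "M_coord f \<alpha> = pseries.representation (M ` compositions) f (M \<alpha>)"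

definition M_supp :: "pseries \<Rightarrow> nat list set"
  where "M_supp f = {\<alpha> \<in> compositions. M_coord f \<alpha> \<noteq> 0}"


section \<open>Coproduct and Hopf algebra endomorphisms\<close>

text \<open>The tensor square of \<open>QSym\<close> is the free vector space on the pairs of compositions, the pair
  \<open>(\<beta>, \<gamma>)\<close> standing for the basis element \<open>M \<beta> \<otimes> M \<gamma>\<close>.\<close>

type_synonym qtensor = "(nat list \<times> nat list) \<Rightarrow>\<^sub>0 rat"

definition tensor :: "pseries \<Rightarrow> pseries \<Rightarrow> qtensor" where
  "tensor f g = (\<Sum>\<beta> \<in> M_supp f. \<Sum>\<gamma> \<in> M_supp g.
     Poly_Mapping.single (\<beta>, \<gamma>) (M_coord f \<beta> * M_coord g \<gamma>))"

definition coproduct :: "pseries \<Rightarrow> qtensor" where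
  "coproduct f = (\<Sum>\<alpha> \<in> M_supp f. \<Sum>(\<beta>, \<gamma>) \<in> {(\<beta>, \<gamma>). \<beta> @ \<gamma> = \<alpha>}.
     Poly_Mapping.single (\<beta>, \<gamma>) (M_coord f \<alpha>))"

definition counit :: "pseries \<Rightarrow> rat"
  where "counit f = M_coord f []"

definition tensor_map :: "(pseries \<Rightarrow> pseries) \<Rightarrow> (pseries \<Rightarrow> pseries) \<Rightarrow> qtensor \<Rightarrow> qtensor" where
  "tensor_map \<Phi> \<Psi> t = (\<Sum>(\<beta>, \<gamma>) \<in> Poly_Mapping.keys t.
     Poly_Mapping.map (\<lambda>x. Poly_Mapping.lookup t (\<beta>, \<gamma>) * x) (tensor (\<Phi> (M \<beta>)) (\<Psi> (M \<gamma>))))"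

text \<open>Only the values of \<open>\<Phi>\<close> on \<open>QSym\<close> matter. Compatibility with the antipode is not required
  separately, since every bialgebra morphism between Hopf algebras has it.\<close>

definition QSym_End :: "(pseries \<Rightarrow> pseries) set" where
  "QSym_End = {\<Phi>.
     (\<forall>n. \<Phi> ` QSym_deg n \<subseteq> QSym_deg n) \<and>
     (\<forall>f \<in> QSym. \<forall>g \<in> QSym. \<Phi> (f + g) = \<Phi> f + \<Phi> g) \<and>
     (\<forall>c. \<forall>f \<in> QSym. \<Phi> (scale c f) = scale c (\<Phi> f)) \<and>
     \<Phi> 1 = 1 \<and>
     (\<forall>f \<in> QSym. \<forall>g \<in> QSym. \<Phi> (f * g) = \<Phi> f * \<Phi> g) \<and>
     (\<forall>f \<in> QSym. counit (\<Phi> f) = counit f) \<and>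
     (\<forall>f \<in> QSym. coproduct (\<Phi> f) = tensor_map \<Phi> \<Phi> (coproduct f))}"

definition F_coeff :: "(pseries \<Rightarrow> pseries) \<Rightarrow> nat list \<Rightarrow> nat list \<Rightarrow> rat" where
  "F_coeff \<Phi> \<alpha> \<beta> = pseries.representation (F ` compositions) (\<Phi> (F \<alpha>)) (F \<beta>)"

definition lam :: "(pseries \<Rightarrow> pseries) \<Rightarrow> rat"
  where "lam \<Phi> = (THE l. \<Phi> (M [1]) = scale l (M [1]))"


section \<open>The Markov chains\<close>

definition Sym :: "nat \<Rightarrow> (nat \<Rightarrow> nat) set"
  where "Sym n = {\<sigma>. \<sigma> permutes {1..n}}"

definition D :: "nat \<Rightarrow> (nat \<Rightarrow> nat) \<Rightarrow> nat list"
  where "D n \<sigma> = co n {i \<in> {1..<n}. \<sigma> i > \<sigma> (i + 1)}"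

definition Prob :: "nat \<Rightarrow> (pseries \<Rightarrow> pseries) \<Rightarrow> (nat \<Rightarrow> nat) \<Rightarrow> real" where
  "Prob n \<Phi> \<pi> = of_rat (F_coeff \<Phi> (D n \<pi>) (one_part n) /
                        (\<Sum>\<sigma> \<in> Sym n. F_coeff \<Phi> (D n \<sigma>) (one_part n)))"

text \<open>The defining equation \<open>K(\<pi>, \<sigma>\<pi>) = Prob(\<sigma>\<inverse>)\<close>, written with \<open>\<tau> = \<sigma>\<pi>\<close>.\<close>

definition K :: "nat \<Rightarrow> (pseries \<Rightarrow> pseries) \<Rightarrow> (nat \<Rightarrow> nat) \<Rightarrow> (nat \<Rightarrow> nat) \<Rightarrow> real"
  where "K n \<Phi> \<pi> \<tau> = (let \<sigma> = \<tau> \<circ> inv \<pi> in Prob n \<Phi> (inv \<sigma>))"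

definition K_bar :: "nat \<Rightarrow> (pseries \<Rightarrow> pseries) \<Rightarrow> nat list \<Rightarrow> nat list \<Rightarrow> real"
  where "K_bar n \<Phi> \<alpha> \<beta> = of_rat (F_coeff \<Phi> \<alpha> \<beta> / lam \<Phi> ^ n)"

definition stochastic_matrix :: "'a set \<Rightarrow> ('a \<Rightarrow> 'a \<Rightarrow> real) \<Rightarrow> bool" where
  "stochastic_matrix X P \<longleftrightarrow>
     (\<forall>x \<in> X. \<forall>y \<in> X. 0 \<le> P x y) \<and> (\<forall>x \<in> X. (\<Sum>y \<in> X. P x y) = 1)"

definition probability_vector :: "'a set \<Rightarrow> ('a \<Rightarrow> real) \<Rightarrow> bool"
  where "probability_vector X \<mu> \<longleftrightarrow> (\<forall>x \<in> X. 0 \<le> \<mu> x) \<and> (\<Sum>x \<in> X. \<mu> x) = 1"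

definition stationary_distribution :: "'a set \<Rightarrow> ('a \<Rightarrow> 'a \<Rightarrow> real) \<Rightarrow> ('a \<Rightarrow> real) \<Rightarrow> bool" where
  "stationary_distribution X P \<mu> \<longleftrightarrow>
     stochastic_matrix X P \<and> probability_vector X \<mu> \<and> (\<forall>y \<in> X. (\<Sum>x \<in> X. \<mu> x * P x y) = \<mu> y)"

definition unique_stationary_distribution ::
    "'a set \<Rightarrow> ('a \<Rightarrow> 'a \<Rightarrow> real) \<Rightarrow> ('a \<Rightarrow> real) \<Rightarrow> bool" where
  "unique_stationary_distribution X P \<mu> \<longleftrightarrow>
     stationary_distribution X P \<mu> \<and>
     (\<forall>\<nu>. stationary_distribution X P \<nu> \<longrightarrow> (\<forall>x \<in> X. \<nu> x = \<mu> x))"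

end

theory Submission
  imports Defs "HOL-Library.FuncSet" "HOL-Library.Multiset"
begin

text \<open>
  Write \<open>\<chi>(w) = c\<^bsub>D(w),(n)\<^esub>\<close> for the coefficient of \<open>M\<^bsub>(n)\<^esub>\<close> in \<open>\<Phi> F\<^bsub>D(w)\<^esub>\<close>, where \<open>w\<close> is a word
  of length \<open>n\<close> with distinct letters. Since \<open>\<Phi>\<close> respects deconcatenation, the coefficient of \<open>M\<^sub>\<beta>\<close>
  in \<open>\<Phi> F\<^bsub>D(w)\<^esub>\<close> is the product of \<open>\<chi>\<close> over the consecutive factors of \<open>w\<close> of lengths \<open>\<beta>\<close>. Since
  \<open>\<Phi>\<close> is multiplicative and \<open>F\<^sub>u F\<^sub>v = \<Sum> F\<^sub>w\<close> over the shuffles \<open>w\<close> of \<open>u\<close> and \<open>v\<close>, this product is the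
  sum of \<open>\<chi>\<close> over the shuffles of these factors. Moebius inversion over refinements turns this into
  \<open>c\<^bsub>D(\<pi>),\<gamma>\<^esub> = \<Sum> \<chi>(\<pi> \<tau>\<^sup>-\<^sup>1)\<close>, summed over the \<open>\<tau>\<close> with \<open>D(\<tau>) = \<gamma>\<close>; the finest case
  \<open>\<beta> = (1\<^sup>n)\<close> gives \<open>\<Sum> \<chi>(\<sigma>) = \<lambda>\<^sup>n\<close>. Hence \<open>K_bar\<close> is the lumping of the doubly stochastic matrix \<open>K\<close>
  along \<open>D\<close>.

  Uniqueness needs that the permutations with descent composition \<open>\<alpha>\<close> generate the symmetric group.
  As \<open>\<alpha>\<close> is neither \<open>(n)\<close> nor \<open>(1\<^sup>n)\<close>, there is a peak or a valley at some inner position \<open>p\<close>. Put the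
  extremal letter \<open>e \<in> {n, 1}\<close> there: the remaining letters can be distributed arbitrarily between
  the two sides, so \<open>k\<close> and \<open>k + 1\<close> can be placed on different sides, and exchanging them does not
  change the descents. This gives the stabilizer of \<open>e\<close>, which together with a permutation moving
  \<open>e\<close> generates everything.
\<close>

section \<open>Compositions, monomials and descents\<close>

text \<open>Positions count from 1, as for permutations, while lists are indexed from 0; hence
  \<open>i - 1\<close> and \<open>i\<close> address the \<open>i\<close>-th letter and its
  successor.\<close>

definition descents :: "nat list \<Rightarrow> nat set"
  where "descents w = {i \<in> {1..<length w}. w ! (i - 1) > w ! i}"

definition rises :: "nat list \<Rightarrow> nat set"
  where "rises l = {i \<in> {1..<length l}. l ! (i - 1) < l ! i}"

text \<open>In contrast to \<open>S_of\<close>, the set of partial sums includes \<open>0\<close> and the total sum; this makes it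
  behave uniformly under concatenation.\<close>

definition partial_sums :: "nat list \<Rightarrow> nat set"
  where "partial_sums \<alpha> = {sum_list (take i \<alpha>) | i. i \<le> length \<alpha>}"

lemma partial_sums_Nil [simp]: "partial_sums [] = {0}"
  by (auto simp: partial_sums_def)

lemma partial_sums_Cons: "partial_sums (a # \<alpha>) = insert 0 ((+) a ` partial_sums \<alpha>)"
proof (intro equalityI subsetI)
  fix x assume "x \<in> partial_sums (a # \<alpha>)"
  then obtain i where "x = sum_list (take i (a # \<alpha>))" "i \<le> Suc (length \<alpha>)" by (auto simp: partial_sums_def)
  then show "x \<in> insert 0 ((+) a ` partial_sums \<alpha>)" by (cases i) (auto simp: partial_sums_def)
next
  fix x assume "x \<in> insert 0 ((+) a ` partial_sums \<alpha>)"
  then consider "x = 0" | i where "x = a + sum_list (take i \<alpha>)" "i \<le> length \<alpha>" by (auto simp: partial_sums_def)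
  then show "x \<in> partial_sums (a # \<alpha>)"
  proof cases
    case 1 then show ?thesis by (auto simp: partial_sums_def intro: exI[of _ 0])
  next
    case 2 then show ?thesis unfolding partial_sums_def mem_Collect_eq by (intro exI[of _ "Suc i"]) simp
  qed
qed

lemma zero_in_partial_sums [simp]: "0 \<in> partial_sums \<alpha>"
  by (cases \<alpha>) (auto simp: partial_sums_Cons)

lemma sum_list_in_partial_sums [simp]: "sum_list \<alpha> \<in> partial_sums \<alpha>"
  by (induction \<alpha>) (auto simp: partial_sums_Cons)

lemma partial_sums_le: "i \<in> partial_sums \<alpha> \<Longrightarrow> i \<le> sum_list \<alpha>"
  by (induction \<alpha> arbitrary: i) (auto simp: partial_sums_Cons)

lemma finite_partial_sums [simp]: "finite (partial_sums \<alpha>)"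
  by (induction \<alpha>) (auto simp: partial_sums_Cons)

lemma partial_sums_append: "partial_sums (\<alpha> @ \<beta>) = partial_sums \<alpha> \<union> (+) (sum_list \<alpha>) ` partial_sums \<beta>"
  by (induction \<alpha>) (auto simp: partial_sums_Cons image_Un image_image add.assoc)

lemma partial_sums_replicate_1 [simp]: "partial_sums (replicate n 1) = {0..n}"
proof (induction n)
  case (Suc n)
  have "(+) 1 ` {0..n} = {1..Suc n}" using image_Suc_atLeastAtMost[of 0 n] by (simp add: plus_1_eq_Suc)
  then show ?case using Suc by (auto simp: partial_sums_Cons)
qed auto

lemma compositions_Cons [simp]: "a # \<alpha> \<in> compositions \<longleftrightarrow> 0 < a \<and> \<alpha> \<in> compositions"
  by (auto simp: compositions_def)

lemma compositions_Nil [simp]: "[] \<in> compositions"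
  by (auto simp: compositions_def)

lemma compositions_append [simp]: "\<alpha> @ \<beta> \<in> compositions \<longleftrightarrow> \<alpha> \<in> compositions \<and> \<beta> \<in> compositions"
  by (auto simp: compositions_def)

text \<open>Positive parts make the partial sums strictly increasing, so deleting the values 0 and
  \<open>sum_list \<alpha>\<close> deletes exactly the empty and the full prefix.\<close>

lemma S_of_eq_partial_sums:
  assumes "\<alpha> \<in> compositions"
  shows "S_of \<alpha> = partial_sums \<alpha> - {0, sum_list \<alpha>}"
proof -
  have less: "sum_list (take i \<alpha>) < sum_list (take j \<alpha>)" if "i < j" "j \<le> length \<alpha>" for i j
  proof -
    have "take j \<alpha> = take i \<alpha> @ take (j - i) (drop i \<alpha>)"
      using that by (metis le_add_diff_inverse less_imp_le take_add)
    moreover have "take (j - i) (drop i \<alpha>) \<noteq> []" using that by auto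
    moreover have "\<forall>a \<in> set (take (j - i) (drop i \<alpha>)). 0 < a"
      using assms by (auto simp: compositions_def dest: in_set_takeD in_set_dropD)
    ultimately show ?thesis
      by (cases "take (j - i) (drop i \<alpha>)") auto
  qed
  show ?thesis
  proof (intro equalityI subsetI)
    fix x assume "x \<in> S_of \<alpha>"
    then obtain i where i: "x = sum_list (take i \<alpha>)" "1 \<le> i" "i < length \<alpha>" by (auto simp: S_of_def)
    then have "0 < x" "x < sum_list \<alpha>"
      using less[of 0 i] less[of i "length \<alpha>"] by simp_all
    moreover have "x \<in> partial_sums \<alpha>" using i by (auto simp: partial_sums_def)
    ultimately show "x \<in> partial_sums \<alpha> - {0, sum_list \<alpha>}" by simp
  next
    fix x assume "x \<in> partial_sums \<alpha> - {0, sum_list \<alpha>}"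
    then obtain i where i: "x = sum_list (take i \<alpha>)" "i \<le> length \<alpha>" "x \<noteq> 0" "x \<noteq> sum_list \<alpha>"
 unfolding partial_sums_def by blast
    have "i \<noteq> 0" using i by (cases i) simp_all
    moreover have "i \<noteq> length \<alpha>" using i by (cases "i = length \<alpha>") simp_all
    ultimately have "1 \<le> i" "i < length \<alpha>" using i by simp_all
    with i show "x \<in> S_of \<alpha>" by (auto simp: S_of_def intro!: exI[of _ i])
  qed
qed

text \<open>The first part of a nonempty composition is its least positive partial sum; after
  peeling it off on both sides, induction compares the rests.\<close>

lemma inj_on_S_of: "inj_on S_of (Comp n)"
proof -
  have "\<alpha> = \<beta>" if "\<alpha> \<in> compositions" "\<beta> \<in> compositions" "partial_sums \<alpha> = partial_sums \<beta>" for \<alpha> \<beta>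
    using that
  proof (induction \<alpha> arbitrary: \<beta>)
    case Nil
    then have "i = 0" if "i \<in> partial_sums \<beta>" for i using that by (metis partial_sums_Nil singletonD)
    then have "sum_list \<beta> = 0" using sum_list_in_partial_sums by blast
    then show ?case using Nil by (cases \<beta>) auto
  next
    case (Cons a \<alpha>)
    then obtain b \<gamma> where \<beta>: "\<beta> = b # \<gamma>"
      using sum_list_in_partial_sums[of "a # \<alpha>"] by (cases \<beta>) (auto simp del: sum_list_in_partial_sums)
    have pos: "0 < a" "0 < b" using Cons.prems \<beta> by auto
    have im: "(+) a ` partial_sums \<alpha> = (+) b ` partial_sums \<gamma>"
    proof -
      have "0 \<notin> (+) a ` partial_sums \<alpha>" "0 \<notin> (+) b ` partial_sums \<gamma>" using pos by auto
      then show ?thesis using Cons.prems(3) unfolding \<beta> partial_sums_Cons by (metis insert_ident)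
    qed
    then have "a = b"
    proof -
      have "a \<in> (+) a ` partial_sums \<alpha>" "b \<in> (+) b ` partial_sums \<gamma>" by (auto intro!: image_eqI[of _ _ 0])
      then have "a \<in> (+) b ` partial_sums \<gamma>" "b \<in> (+) a ` partial_sums \<alpha>" using im by auto
      then show ?thesis by auto
    qed
    with im have "partial_sums \<alpha> = partial_sums \<gamma>" by (metis inj_image_eq_iff inj_on_add)
    with Cons \<beta> \<open>a = b\<close> show ?case by auto
  qed
  moreover have "partial_sums \<alpha> = insert 0 (insert n (S_of \<alpha>))" if "\<alpha> \<in> Comp n" for \<alpha>
    using that sum_list_in_partial_sums[of \<alpha>] zero_in_partial_sums[of \<alpha>] by (auto simp: Comp_def S_of_eq_partial_sums)
  ultimately show ?thesis unfolding inj_on_def by (metis (no_types, lifting) Comp_def mem_Collect_eq)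
qed

lemma S_of_subset: "\<alpha> \<in> Comp n \<Longrightarrow> S_of \<alpha> \<subseteq> {1..<n}"
  using partial_sums_le[of _ \<alpha>] by (fastforce simp: Comp_def S_of_eq_partial_sums)

lemma subset_S_of_iff:
  assumes "\<alpha> \<in> Comp n" "A \<subseteq> {1..<n}"
  shows "A \<subseteq> S_of \<alpha> \<longleftrightarrow> A \<subseteq> partial_sums \<alpha>"
  using assms by (auto simp: Comp_def S_of_eq_partial_sums)

lemma descents_subset: "descents w \<subseteq> {1..<length w}"
  by (auto simp: descents_def)

lemma rises_subset: "rises l \<subseteq> {1..<length l}"
  by (auto simp: rises_def)

text \<open>A descent of \<open>w\<close> lies inside the prefix, inside the suffix, or at the cut.
  The cut \<open>sum_list \<alpha>\<close> is itself a partial sum, so a descent there is always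
  allowed and the condition splits into two independent ones.\<close>

lemma descents_subset_partial_sums_append_iff:
  assumes "sum_list \<alpha> \<le> length w" "sum_list \<beta> = length w - sum_list \<alpha>"
  shows "descents w \<subseteq> partial_sums (\<alpha> @ \<beta>) \<longleftrightarrow>
           descents (take (sum_list \<alpha>) w) \<subseteq> partial_sums \<alpha> \<and> descents (drop (sum_list \<alpha>) w) \<subseteq> partial_sums \<beta>"
proof -
  define b where "b = sum_list \<alpha>"
  have b: "b \<le> length w" using assms b_def by simp
  have 1: "i \<in> descents (take b w) \<longleftrightarrow> i \<in> descents w \<and> i < b" for i
    using b by (auto simp: descents_def)
  have 2: "i \<in> descents (drop b w) \<longleftrightarrow> b + i \<in> descents w \<and> 0 < i" for i
    using b by (auto simp: descents_def)
  have 3: "i \<in> partial_sums (\<alpha> @ \<beta>) \<longleftrightarrow> i \<in> partial_sums \<alpha>" if "i < b" for i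
    using that by (auto simp: partial_sums_append b_def)
  have 4: "b + i \<in> partial_sums (\<alpha> @ \<beta>) \<longleftrightarrow> i \<in> partial_sums \<beta>" for i
    using partial_sums_le[of "b + i" \<alpha>] by (auto simp: partial_sums_append b_def)
  show ?thesis unfolding b_def[symmetric]
  proof (intro iffI conjI subsetI)
    fix i assume "descents w \<subseteq> partial_sums (\<alpha> @ \<beta>)" "i \<in> descents (take b w)"
    then show "i \<in> partial_sums \<alpha>" using 1 3 by auto
  next
    fix i assume "descents w \<subseteq> partial_sums (\<alpha> @ \<beta>)" "i \<in> descents (drop b w)"
    then show "i \<in> partial_sums \<beta>" using 2 4 by auto
  next
    fix i assume *: "descents (take b w) \<subseteq> partial_sums \<alpha> \<and> descents (drop b w) \<subseteq> partial_sums \<beta>" and i: "i \<in> descents w"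
    consider "i < b" | "i = b" | "i > b" by linarith
    then show "i \<in> partial_sums (\<alpha> @ \<beta>)"
    proof cases
      case 1 then show ?thesis using * i 3 \<open>\<And>i. i \<in> descents (take b w) \<longleftrightarrow> _\<close> by auto
    next
      case 2 then show ?thesis using 4[of 0] by auto
    next
      case 3
      then have "i - b \<in> descents (drop b w)" using 2[of "i - b"] i by auto
      then show ?thesis using * 4[of "i - b"] 3 by auto
    qed
  qed
qed

section \<open>Monomials as words of variable indices\<close>

definition monom_of :: "nat list \<Rightarrow> monom"
  where "monom_of l = sum_list (map (\<lambda>i. Poly_Mapping.single i 1) l)"

lemma monom_of_Nil [simp]: "monom_of [] = 0" by (simp add: monom_of_def)
lemma monom_of_Cons: "monom_of (x # l) = Poly_Mapping.single x 1 + monom_of l" by (simp add: monom_of_def)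
lemma monom_of_append: "monom_of (l @ l') = monom_of l + monom_of l'" by (simp add: monom_of_def)

lemma monom_of_replicate: "monom_of (replicate k x) = Poly_Mapping.single x k"
  by (induction k) (auto simp: monom_of_Cons single_add[symmetric])

lemma lookup_monom_of: "Poly_Mapping.lookup (monom_of l) i = count (mset l) i"
  by (induction l) (auto simp: monom_of_Cons lookup_add lookup_single)

lemma monom_of_eq_iff: "monom_of l = monom_of l' \<longleftrightarrow> mset l = mset l'"
proof
  assume "monom_of l = monom_of l'"
  then have "count (mset l) i = count (mset l') i" for i by (metis lookup_monom_of)
  then show "mset l = mset l'" by (rule multiset_eqI)
next
  assume "mset l = mset l'"
  then show "monom_of l = monom_of l'" by (intro poly_mapping_eqI) (simp add: lookup_monom_of)
qed

text \<open>Sorted words are normal forms of monomials; together with \<open>monom_of_surj\<close>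
  this allows power series to be compared on sorted words alone.\<close>

lemma monom_of_sorted_inj: "sorted l \<Longrightarrow> sorted l' \<Longrightarrow> monom_of l = monom_of l' \<longleftrightarrow> l = l'"
  by (metis monom_of_eq_iff properties_for_sort)

lemma monom_of_surj:
  obtains l where "sorted l" "m = monom_of l"
proof -
  define N where "N = (\<Sum>i\<in>Poly_Mapping.keys m. replicate_mset (Poly_Mapping.lookup m i) i)"
  obtain l where l: "mset l = N" using ex_mset by blast
  have "count N i = Poly_Mapping.lookup m i" for i
    by (auto simp: N_def count_sum in_keys_iff sum.delta cong: if_cong)
  then have "monom_of (sort l) = m" using l by (intro poly_mapping_eqI) (simp add: lookup_monom_of)
  then show ?thesis using that[of "sort l"] by auto
qed

text \<open>For strictly increasing \<open>is\<close> of the same length as \<open>\<alpha>\<close>,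
  this is the sorted word of the term of \<open>M \<alpha>\<close> at the indices
  \<open>is\<close>.\<close>

fun runs :: "nat list \<Rightarrow> nat list \<Rightarrow> nat list" where
  "runs (a # \<alpha>) (i # is) = replicate a i @ runs \<alpha> is"
| "runs _ _ = []"

lemma set_runs: "set (runs \<alpha> is) \<subseteq> set is"
  by (induction \<alpha> "is" rule: runs.induct) auto

lemma length_runs: "length is = length \<alpha> \<Longrightarrow> length (runs \<alpha> is) = sum_list \<alpha>"
  by (induction \<alpha> "is" rule: runs.induct) auto

lemma sorted_runs: "sorted_wrt (<) is \<Longrightarrow> sorted (runs \<alpha> is)"
proof (induction \<alpha> "is" rule: runs.induct)
  case (1 a \<alpha> i "is")
  then show ?case using set_runs[of \<alpha> "is"] by (fastforce simp: sorted_append)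
qed auto

lemma monom_of_runs:
  "length is = length \<alpha> \<Longrightarrow>
     monom_of (runs \<alpha> is) = (\<Sum>j<length \<alpha>. Poly_Mapping.single (is ! j) (\<alpha> ! j))"
  by (induction \<alpha> "is" rule: runs.induct)
     (auto simp: monom_of_append monom_of_replicate sum.lessThan_Suc_shift simp del: sum.lessThan_Suc)

lemma rises_replicate_append:
  assumes "0 < a" "\<forall>y \<in> set l. x < y"
  shows "rises (replicate a x @ l) = (if l = [] then {} else insert a ((+) a ` rises l))"
proof (intro equalityI subsetI)
  fix i assume "i \<in> rises (replicate a x @ l)"
  then have i: "1 \<le> i" "i < a + length l" "(replicate a x @ l) ! (i - 1) < (replicate a x @ l) ! i"
    by (auto simp: rises_def)
  consider "i < a" | "i = a" | "i > a" by linarith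
  then show "i \<in> (if l = [] then {} else insert a ((+) a ` rises l))"
  proof cases
    case 1
    then have "i - 1 < a" by simp
    then show ?thesis using i 1 by (simp add: nth_append)
  next
    case 2 then show ?thesis using i by auto
  next
    case 3
    then have "\<not> i - 1 < a" "i - Suc a = i - 1 - a" by simp_all
    then have "i - a \<in> rises l" using i 3 by (simp add: rises_def nth_append) arith
    moreover have "i = a + (i - a)" using 3 by simp
    ultimately have "i \<in> (+) a ` rises l" by blast
    then show ?thesis using i 3 by auto
  qed
next
  fix i assume *: "i \<in> (if l = [] then {} else insert a ((+) a ` rises l))"
  then have l: "l \<noteq> []" by (auto split: if_splits)
  with * consider "i = a" | j where "i = a + j" "j \<in> rises l" by auto
  then show "i \<in> rises (replicate a x @ l)"
  proof cases
    case 1 then show ?thesis using assms l by (auto simp: rises_def nth_append)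
  next
    case 2 then show ?thesis using assms by (auto simp: rises_def nth_append)
  qed
qed

lemma S_of_Cons:
  assumes "a # \<alpha> \<in> compositions"
  shows "S_of (a # \<alpha>) = (if \<alpha> = [] then {} else insert a ((+) a ` S_of \<alpha>))"
proof (cases "\<alpha> = []")
  case True
  then show ?thesis using assms by (auto simp: S_of_eq_partial_sums partial_sums_Cons)
next
  case False
  then have "0 < sum_list \<alpha>" using assms by (cases \<alpha>) auto
  then show ?thesis using False assms by (auto simp: S_of_eq_partial_sums partial_sums_Cons)
qed

text \<open>The word rises exactly where a new run begins, that is, at the proper partial sums of
  the run lengths.\<close>

lemma rises_runs:
  "length is = length \<alpha> \<Longrightarrow> \<alpha> \<in> compositions \<Longrightarrow> sorted_wrt (<) is \<Longrightarrow> rises (runs \<alpha> is) = S_of \<alpha>"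
proof (induction \<alpha> "is" rule: runs.induct)
  case (1 a \<alpha> i "is")
  then have IH: "rises (runs \<alpha> is) = S_of \<alpha>" by auto
  have "\<forall>y \<in> set (runs \<alpha> is). i < y" using 1 set_runs[of \<alpha> "is"] by auto
  then have *: "rises (runs (a # \<alpha>) (i # is)) =
      (if runs \<alpha> is = [] then {} else insert a ((+) a ` rises (runs \<alpha> is)))"
    using rises_replicate_append[of a "runs \<alpha> is" i] 1 by auto
  have "runs \<alpha> is = [] \<longleftrightarrow> \<alpha> = []" using 1 by (cases \<alpha>; cases "is") auto
  then show ?case using * IH S_of_Cons[of a \<alpha>] 1 by auto
qed (auto simp: rises_def S_of_def)

lemma runs_inj:
  "length is = length \<alpha> \<Longrightarrow> length is' = length \<alpha> \<Longrightarrow> \<alpha> \<in> compositions \<Longrightarrow>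
     runs \<alpha> is = runs \<alpha> is' \<Longrightarrow> is = is'"
proof (induction \<alpha> arbitrary: "is" is')
  case (Cons a \<alpha>)
  then obtain i js i' js' where eq: "is = i # js" "is' = i' # js'" by (metis length_Suc_conv)
  with Cons.prems have "replicate a i = replicate a i'" "runs \<alpha> js = runs \<alpha> js'" "0 < a" by auto
  then show ?case using Cons eq by (auto simp: replicate_eq_replicate)
qed auto

text \<open>This is run-length encoding. The conjunct \<open>set is = set l\<close> strengthens the
  induction: it locates a new first letter relative to the indices already found.\<close>

lemma runs_surj:
  "sorted l \<Longrightarrow> \<exists>\<alpha> is. length is = length \<alpha> \<and> \<alpha> \<in> compositions \<and> sorted_wrt (<) is \<and> l = runs \<alpha> is
      \<and> set is = set l"
proof (induction l)
  case Nil
  then show ?case by (intro exI[of _ "[]"]) simp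
next
  case (Cons x l)
  then obtain \<alpha> "is" where *: "length is = length \<alpha>" "\<alpha> \<in> compositions" "sorted_wrt (<) is"
    "l = runs \<alpha> is" "set is = set l" by auto
  show ?case
  proof (cases "x \<in> set l")
    case False
    then have "\<forall>y \<in> set is. x < y" using Cons.prems *(5) by (auto simp: less_le)
    then show ?thesis using *
      by (intro exI[of _ "1 # \<alpha>"] exI[of _ "x # is"]) simp
  next
    case True
    then obtain i js a \<beta> where eq: "is = i # js" "\<alpha> = a # \<beta>"
      using * by (cases "is"; cases \<alpha>) auto
    have "i \<in> set l" using * eq by auto
    have "x = i" 
    proof (rule antisym)
      show "x \<le> i" using Cons.prems \<open>i \<in> set l\<close> by auto
      have "x \<in> set is" using True * by auto
      then show "i \<le> x" using *(3) eq by auto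
    qed
    then show ?thesis using * eq
      by (intro exI[of _ "Suc a # \<beta>"] exI[of _ "i # js"]) auto
  qed
qed

text \<open>A sorted word has a single run-length encoding, whose run lengths are determined by the
  length and the rises of the word. So at most one index sequence in the definition of
  \<open>M\<close> produces the monomial.\<close>

lemma coeff_M:
  assumes "\<alpha> \<in> compositions" "sorted l"
  shows "coeff (M \<alpha>) (monom_of l) = (if length l = sum_list \<alpha> \<and> rises l = S_of \<alpha> then 1 else 0)"
proof -
  let ?A = "{is. length is = length \<alpha> \<and> sorted_wrt (<) is \<and> l = runs \<alpha> is}"
  have "{is. length is = length \<alpha> \<and> sorted_wrt (<) is \<and>
          monom_of l = (\<Sum>j<length \<alpha>. Poly_Mapping.single (is ! j) (\<alpha> ! j))} = ?A"
    using monom_of_runs monom_of_sorted_inj[OF assms(2)] sorted_runs by (metis (no_types, lifting))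
  then have c: "coeff (M \<alpha>) (monom_of l) = of_nat (card ?A)"
    by (simp add: M_def Abs_pseries_inverse)
  obtain \<beta> js where *: "length js = length \<beta>" "\<beta> \<in> compositions" "sorted_wrt (<) js" "l = runs \<beta> js"
    using runs_surj[OF assms(2)] by blast
  have "length l = sum_list \<beta>" "rises l = S_of \<beta>"
    using * length_runs rises_runs by auto
  then have **: "length l = sum_list \<alpha> \<and> rises l = S_of \<alpha> \<longleftrightarrow> \<alpha> = \<beta>"
    using inj_on_S_of[of "length l"] assms * by (auto simp: inj_on_def Comp_def)
  show ?thesis
  proof (cases "\<alpha> = \<beta>")
    case True
    have "is = js" if "is \<in> ?A" for "is"
      by (rule runs_inj[of _ \<alpha>]) (use that * True assms in auto)
    then have "?A = {js}" using * True by blast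
    then show ?thesis using c ** True by simp
  next
    case False
    have "?A = {}"
    proof (rule ccontr)
      assume "?A \<noteq> {}"
      then obtain "is" where "length is = length \<alpha>" "sorted_wrt (<) is" "l = runs \<alpha> is" by blast
      then have "length l = sum_list \<alpha>" "rises l = S_of \<alpha>"
        using length_runs rises_runs assms(1) by auto
      then show False using ** False by simp
    qed
    then have "card ?A = 0" by (simp only: card.empty)
    then show ?thesis using c ** False by simp
  qed
qed

section \<open>Compositions of n and subsets of {1..<n}\<close>

lemma S_of_image_Comp: "S_of ` Comp n = Pow {1..<n}"
proof (intro equalityI subsetI)
  fix S assume "S \<in> S_of ` Comp n"
  then show "S \<in> Pow {1..<n}" using S_of_subset by auto
next
  fix S assume "S \<in> Pow {1..<n}"
  then have S: "S \<subseteq> {1..<n}" "finite S" by (auto intro: finite_subset)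
  \<comment> \<open>The letter at 0-based place \<open>j\<close> counts the elements of
    \<open>S\<close> up to \<open>j\<close>, so the word rises exactly at the elements of
    \<open>S\<close>; its run lengths form the composition sought.\<close>
  define l where "l = map (\<lambda>j. card {s \<in> S. s \<le> j}) [0..<n]"
  have "sorted l" unfolding l_def sorted_iff_nth_mono
    using S by (auto intro!: card_mono)
  have "length l = n" by (simp add: l_def)
  have "rises l = S"
  proof -
    have "card {s \<in> S. s \<le> i - 1} < card {s \<in> S. s \<le> i} \<longleftrightarrow> i \<in> S" if "1 \<le> i" for i
    proof (cases "i \<in> S")
      case True
      then have "i \<in> {s \<in> S. s \<le> i}" "i \<notin> {s \<in> S. s \<le> i - 1}" using that by auto
      moreover have "{s \<in> S. s \<le> i - 1} \<subseteq> {s \<in> S. s \<le> i}" by auto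
      ultimately have "{s \<in> S. s \<le> i - 1} \<subset> {s \<in> S. s \<le> i}" by blast
      then show ?thesis using True S by (auto intro: psubset_card_mono)
    next
      case False
      have "s \<le> i - 1 \<longleftrightarrow> s \<le> i" if "s \<in> S" for s 
        using False that \<open>1 \<le> i\<close> by (cases "s = i") auto
      then have "{s \<in> S. s \<le> i - 1} = {s \<in> S. s \<le> i}" by auto
      then show ?thesis using False by auto
    qed
    then have "rises l = {i \<in> {1..<n}. i \<in> S}" by (auto simp: rises_def l_def)
    then show ?thesis using S by auto
  qed
  obtain \<beta> js where *: "length js = length \<beta>" "\<beta> \<in> compositions" "sorted_wrt (<) js" "l = runs \<beta> js"
    using runs_surj[OF \<open>sorted l\<close>] by blast
  have "sum_list \<beta> = n" "S_of \<beta> = S"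
    using * length_runs[of js \<beta>] rises_runs[of js \<beta>] \<open>rises l = S\<close> \<open>length l = n\<close> by auto
  then show "S \<in> S_of ` Comp n" using * by (auto simp: Comp_def)
qed

lemma co_in_Comp: "S \<subseteq> {1..<n} \<Longrightarrow> co n S \<in> Comp n"
  unfolding co_def by (rule inv_into_into) (simp add: S_of_image_Comp)

lemma S_of_co [simp]: "S \<subseteq> {1..<n} \<Longrightarrow> S_of (co n S) = S"
  unfolding co_def by (rule f_inv_into_f) (simp add: S_of_image_Comp)

lemma co_S_of [simp]: "\<alpha> \<in> Comp n \<Longrightarrow> co n (S_of \<alpha>) = \<alpha>"
  unfolding co_def by (auto intro: inv_into_f_f inj_on_S_of)

lemma finite_Comp [simp]: "finite (Comp n)"
  by (rule finite_imageD[OF _ inj_on_S_of]) (simp add: S_of_image_Comp)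

lemma coeff_sum: "coeff (\<Sum>x\<in>A. f x) m = (\<Sum>x\<in>A. coeff (f x) m)"
proof (induction A rule: infinite_finite_induct)
  case (insert x A) then show ?case by (simp add: plus_pseries.rep_eq)
qed (auto simp: zero_pseries.rep_eq)

lemma coeff_F:
  assumes "\<alpha> \<in> compositions" "sorted l"
  shows "coeff (F \<alpha>) (monom_of l) = (if length l = sum_list \<alpha> \<and> S_of \<alpha> \<subseteq> rises l then 1 else 0)"
proof -
  let ?n = "sum_list \<alpha>"
  let ?B = "{\<beta> \<in> Comp ?n. S_of \<alpha> \<subseteq> S_of \<beta>}"
  have "coeff (F \<alpha>) (monom_of l) = (\<Sum>\<beta>\<in>?B. if length l = ?n \<and> rises l = S_of \<beta> then 1 else 0)"
    unfolding F_def coeff_sum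
    by (rule sum.cong) (use assms in \<open>auto simp: Comp_def coeff_M\<close>)
  \<comment> \<open>Only the composition belonging to the rise set of \<open>l\<close> can
    contribute, so the sum over refinements collapses.\<close>
  also have "\<dots> = (\<Sum>\<beta>\<in>?B. if \<beta> = co ?n (rises l) \<and> length l = ?n then 1 else 0)"
    using rises_subset[of l] by (intro sum.cong refl if_cong) auto
  also have "\<dots> = (if length l = ?n \<and> S_of \<alpha> \<subseteq> rises l then 1 else 0)"
  proof (cases "length l = ?n")
    case True
    then have "rises l \<subseteq> {1..<?n}" using rises_subset[of l] by simp
    then show ?thesis using co_in_Comp[of "rises l" ?n] True by (simp add: sum.delta')
  qed simp
  finally show ?thesis .
qed

section \<open>The shuffle product of fundamental quasisymmetric functions\<close>

text \<open>Asymmetry forces equal heads, since otherwise each head would stand after the other.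
  Applied to a single element it excludes repetitions, so the tails have equal sets.\<close>

lemma sorted_wrt_unique:
  assumes "sorted_wrt R xs" "sorted_wrt R ys" "set xs = set ys"
    and "\<And>x y. x \<in> set xs \<Longrightarrow> y \<in> set xs \<Longrightarrow> R x y \<Longrightarrow> \<not> R y x"
  shows "xs = ys"
  using assms
proof (induction xs arbitrary: ys)
  case Nil
  then show ?case by simp
next
  case (Cons x xs)
  from Cons.prems(3) obtain y zs where ys: "ys = y # zs" by (cases ys) auto
  have irr: "\<not> R z z" if "z \<in> set (x # xs)" for z using Cons.prems(4)[OF that that] by blast
  have "x = y"
  proof (rule ccontr)
    assume "x \<noteq> y"
    then have "y \<in> set xs" "x \<in> set zs" using Cons.prems(3) ys by auto
    then have "R x y" "R y x" using Cons.prems(1,2) ys by auto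
    then show False using Cons.prems(4)[of x y] \<open>y \<in> set xs\<close> by auto
  qed
  moreover have "x \<notin> set xs" using Cons.prems(1) irr[of x] by auto
  moreover have "y \<notin> set zs" using Cons.prems(2) irr[of y] ys \<open>x = y\<close> by auto
  ultimately have "set xs = set zs" using Cons.prems(3) ys by auto
  then have "xs = zs" using Cons.prems(1,2) ys by (intro Cons.IH Cons.prems(4)) simp_all
  then show ?case using ys \<open>x = y\<close> by simp
qed

definition F_word :: "nat list \<Rightarrow> pseries"
  where "F_word w = F (co (length w) (descents w))"

lemma co_descents_in_Comp [simp]: "co (length w) (descents w) \<in> Comp (length w)"
  using co_in_Comp descents_subset by blast

lemma coeff_F_word:
  assumes "sorted l"
  shows "coeff (F_word w) (monom_of l) = (if length l = length w \<and> descents w \<subseteq> rises l then 1 else 0)"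
proof -
  have "co (length w) (descents w) \<in> compositions" "sum_list (co (length w) (descents w)) = length w"
    using co_descents_in_Comp[of w] by (auto simp: Comp_def simp del: co_descents_in_Comp)
  then show ?thesis unfolding F_word_def using coeff_F[OF _ assms] S_of_co[OF descents_subset] by auto
qed

text \<open>For a word with distinct letters, \<open>F_word w\<close> is the generating function of the maps \<open>f\<close> from
  letters to variables for which \<open>w\<close> lists its letters \<open>x\<close> in lexicographic order of \<open>(f x, x)\<close>. On a
  given set of letters every \<open>f\<close> fits exactly one word, which makes the shuffle rule a bijection.\<close>

definition compatible :: "(nat \<Rightarrow> nat) \<Rightarrow> nat list \<Rightarrow> bool"
  where "compatible f w \<longleftrightarrow> sorted_wrt (\<lambda>x y. f x < f y \<or> (f x = f y \<and> x < y)) w"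

definition filling_monom :: "nat set \<Rightarrow> (nat \<Rightarrow> nat) \<Rightarrow> monom"
  where "filling_monom A f = (\<Sum>x\<in>A. Poly_Mapping.single (f x) 1)"

text \<open>Extensionality makes a filling determined by its values on the letters of
  \<open>w\<close>, so that fillings can be counted.\<close>

definition compatible_fillings :: "monom \<Rightarrow> nat list \<Rightarrow> (nat \<Rightarrow> nat) set"
  where "compatible_fillings m w = {f \<in> set w \<rightarrow>\<^sub>E UNIV. compatible f w \<and> filling_monom (set w) f = m}"

lemma filling_monom_cong: "(\<And>x. x \<in> A \<Longrightarrow> f x = g x) \<Longrightarrow> filling_monom A f = filling_monom A g"
  by (auto simp: filling_monom_def)

lemma compatible_cong: "(\<And>x. x \<in> set w \<Longrightarrow> f x = g x) \<Longrightarrow> compatible f w = compatible g w"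
  unfolding compatible_def sorted_wrt_iff_nth_less by simp

lemma monom_of_map: "distinct w \<Longrightarrow> monom_of (map f w) = filling_monom (set w) f"
  by (simp add: monom_of_def filling_monom_def sum_list_distinct_conv_sum_set o_def)

text \<open>The order is transitive, so comparing neighbours suffices. Equal values are allowed
  between neighbours exactly where the letters increase; a descent forces a strict rise.\<close>

lemma compatible_iff:
  assumes "distinct w"
  shows "compatible f w \<longleftrightarrow> sorted (map f w) \<and> descents w \<subseteq> rises (map f w)"
proof -
  have tr: "transp (\<lambda>x y. f x < f y \<or> (f x = f y \<and> x < y))" by (auto simp: transp_def)
  have D: "descents w \<subseteq> rises (map f w) \<longleftrightarrow>
      (\<forall>i. Suc i < length w \<longrightarrow> w ! Suc i < w ! i \<longrightarrow> f (w ! i) < f (w ! Suc i))"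
  proof (intro iffI allI impI subsetI)
    fix i assume "descents w \<subseteq> rises (map f w)" "Suc i < length w" "w ! Suc i < w ! i"
    moreover from this have "Suc i \<in> descents w" by (auto simp: descents_def)
    ultimately have "Suc i \<in> rises (map f w)" by blast
    then show "f (w ! i) < f (w ! Suc i)" by (auto simp: rises_def)
  next
    fix j assume *: "\<forall>i. Suc i < length w \<longrightarrow> w ! Suc i < w ! i \<longrightarrow> f (w ! i) < f (w ! Suc i)"
      and "j \<in> descents w"
    then show "j \<in> rises (map f w)"
      using *[rule_format, of "j - 1"] by (auto simp: descents_def rises_def)
  qed
  have neq: "w ! i \<noteq> w ! Suc i" if "Suc i < length w" for i
    using assms that by (auto simp: nth_eq_iff_index_eq)
  show ?thesis
    unfolding compatible_def sorted_wrt_iff_nth_Suc_transp[OF tr] sorted_iff_nth_Suc D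
    using neq by (auto simp: le_less) (metis less_linear)+
qed

lemma ex1_extensional_map:
  assumes "distinct w" "length l = length w"
  shows "\<exists>!f. f \<in> set w \<rightarrow>\<^sub>E UNIV \<and> map f w = l"
proof (rule ex_ex1I)
  have "map (restrict (\<lambda>x. the (map_of (zip w l) x)) (set w)) w = l"
    using assms by (intro nth_equalityI) (auto simp: map_of_zip_nth)
  then show "\<exists>f. f \<in> set w \<rightarrow>\<^sub>E UNIV \<and> map f w = l" by (metis UNIV_I restrict_PiE_iff)
next
  fix f g assume *: "f \<in> set w \<rightarrow>\<^sub>E UNIV \<and> map f w = l" "g \<in> set w \<rightarrow>\<^sub>E UNIV \<and> map g w = l"
  then have "\<forall>x\<in>set w. f x = g x" by (metis map_eq_conv)
  then show "f = g" using * by (metis PiE_ext)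
qed

text \<open>Reading a compatible filling along \<open>w\<close> gives a sorted word, and a monomial
  has only one sorted word.\<close>

lemma compatible_fillings_monom_of:
  assumes "distinct w" "sorted l"
  shows "compatible_fillings (monom_of l) w = (if descents w \<subseteq> rises l then {f \<in> set w \<rightarrow>\<^sub>E UNIV. map f w = l} else {})"
proof -
  have "compatible f w \<and> filling_monom (set w) f = monom_of l \<longleftrightarrow> map f w = l \<and> descents w \<subseteq> rises l" for f
    using assms compatible_iff[OF assms(1), of f] monom_of_map[OF assms(1), of f] monom_of_sorted_inj
    by metis
  then show ?thesis unfolding compatible_fillings_def by auto
qed

lemma finite_compatible_fillings:
  assumes "distinct w" shows "finite (compatible_fillings m w)"
proof -
  obtain l where l: "sorted l" "m = monom_of l" by (rule monom_of_surj)
  have "{f \<in> set w \<rightarrow>\<^sub>E UNIV. map f w = l} \<subseteq> {THE f. f \<in> set w \<rightarrow>\<^sub>E UNIV \<and> map f w = l}"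
  proof
    fix f assume f: "f \<in> {f \<in> set w \<rightarrow>\<^sub>E UNIV. map f w = l}"
    then have len: "length l = length w" by auto
    from the1_equality[OF ex1_extensional_map[OF assms len], of f] f
    show "f \<in> {THE f. f \<in> set w \<rightarrow>\<^sub>E UNIV \<and> map f w = l}" by auto
  qed
  then show ?thesis using l compatible_fillings_monom_of[OF assms] by (auto intro: finite_subset)
qed

lemma coeff_F_word_card:
  assumes "distinct w"
  shows "coeff (F_word w) m = of_nat (card (compatible_fillings m w))"
proof -
  obtain l where l: "sorted l" "m = monom_of l" by (rule monom_of_surj)
  have 1: "card {f \<in> set w \<rightarrow>\<^sub>E UNIV. map f w = l} = 1" if len: "length l = length w"
  proof -
    obtain f where "f \<in> set w \<rightarrow>\<^sub>E UNIV \<and> map f w = l"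
      "\<And>g. g \<in> set w \<rightarrow>\<^sub>E UNIV \<and> map g w = l \<Longrightarrow> g = f"
      using ex1_extensional_map[OF assms len] by (metis (no_types, lifting))
    then have "{f \<in> set w \<rightarrow>\<^sub>E UNIV. map f w = l} = {f}" by blast
    then show ?thesis by simp
  qed
  have 2: "{f \<in> set w \<rightarrow>\<^sub>E UNIV. map f w = l} = {}" if "length l \<noteq> length w" using that by auto
  show ?thesis
  proof (cases "length l = length w \<and> descents w \<subseteq> rises l")
    case True
    then show ?thesis using 1 compatible_fillings_monom_of[OF assms l(1)] coeff_F_word[OF l(1), of w] l by auto
  next
    case False
    then have "compatible_fillings (monom_of l) w = {}" using 2 compatible_fillings_monom_of[OF assms l(1)] by auto
    then show ?thesis using False coeff_F_word[OF l(1), of w] l by simp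
  qed
qed

text \<open>For disjoint alphabets a shuffle is recognised by its restrictions to them; this form
  avoids a recursion over interleavings.\<close>

definition word_shuffles :: "nat list \<Rightarrow> nat list \<Rightarrow> nat list set" where
  "word_shuffles u v = {w. distinct w \<and> set w = set u \<union> set v \<and>
     filter (\<lambda>x. x \<in> set u) w = u \<and> filter (\<lambda>x. x \<in> set v) w = v}"

lemma finite_distinct_lists: "finite A \<Longrightarrow> finite {w. distinct w \<and> set w = A}"
  by (rule finite_subset[OF _ finite_subset_distinct[of A]]) auto

lemma finite_word_shuffles [simp]: "finite (word_shuffles u v)"
  by (rule finite_subset[OF _ finite_distinct_lists[of "set u \<union> set v"]]) (auto simp: word_shuffles_def)

lemma compatible_unique:
  assumes "compatible f w" "compatible f w'" "set w = set w'"
  shows "w = w'"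
  using assms unfolding compatible_def by (rule sorted_wrt_unique) auto

lemma compatible_filter: "compatible f w \<Longrightarrow> compatible f (filter P w)"
  unfolding compatible_def by (rule sorted_wrt_filter)

lemma compatible_distinct:
  assumes "compatible f w" shows "distinct w"
proof -
  have "sorted_wrt (\<noteq>) w" using assms unfolding compatible_def by (auto elim: sorted_wrt_mono_rel[rotated])
  then show ?thesis by (simp add: distinct_conv_nth sorted_wrt_iff_nth_less linorder_neq_iff) blast
qed

lemma compatible_exists:
  assumes "finite A"
  obtains w where "set w = A" "compatible f w"
proof -
  define N where "N = Suc (Max (insert 0 A))"
  have N: "x < N" if "x \<in> A" for x using assms that by (auto simp: N_def less_Suc_eq_le)
  \<comment> \<open>With every letter below \<open>N\<close>, this single number orders the letters
    lexicographically by \<open>(f x, x)\<close>, so that \<open>sort_key\<close> applies.\<close>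
  define k where "k x = f x * N + x" for x
  have k: "f x < f y \<or> (f x = f y \<and> x < y)" if "x \<in> A" "y \<in> A" "k x < k y" for x y
  proof (rule ccontr)
    assume "\<not> ?thesis"
    then consider "f y < f x" | "f y = f x" "y \<le> x" by linarith
    then show False
    proof cases
      case 1
      then have "Suc (f y) * N \<le> f x * N" by (intro mult_right_mono) auto
      then show False using that N[of y] by (simp add: k_def)
    next
      case 2 then show False using that by (simp add: k_def)
    qed
  qed
  have inj: "inj_on k A"
  proof (rule inj_onI)
    fix x y assume "x \<in> A" "y \<in> A" "k x = k y"
    then have "k x mod N = k y mod N" by simp
    then show "x = y" using N \<open>x \<in> A\<close> \<open>y \<in> A\<close> by (simp add: k_def)
  qed
  define w where "w = sort_key k (sorted_list_of_set A)"
  have set: "set w = A" using assms by (simp add: w_def)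
  have "distinct (map k w)" using inj set by (simp add: distinct_map w_def)
  then have "sorted_wrt (<) (map k w)" by (simp add: strict_sorted_iff w_def)
  then have "sorted_wrt (\<lambda>x y. k x < k y) w" by (simp add: sorted_wrt_map)
  then have "compatible f w" unfolding compatible_def using k set
    by (auto elim!: sorted_wrt_mono_rel[rotated])
  then show ?thesis using set that by blast
qed

text \<open>The coefficient of the product counts pairs of fillings. As the alphabets are disjoint,
  a pair is one filling of their union, and this is compatible with exactly one word, necessarily a
  shuffle.\<close>

lemma F_word_mult:
  assumes u: "distinct u" and v: "distinct v" and disj: "set u \<inter> set v = {}"
  shows "F_word u * F_word v = (\<Sum>w\<in>word_shuffles u v. F_word w)"
proof (rule pseries_eqI)
  fix m
  let ?A = "set u" and ?B = "set v"
  \<comment> \<open>\<open>J\<close> holds the joint fillings, \<open>S\<close> the same data as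
    pairs of fillings tagged with the splitting of \<open>m\<close>.\<close>
  define J where "J = {h \<in> (?A \<union> ?B) \<rightarrow>\<^sub>E UNIV. compatible h u \<and> compatible h v \<and> filling_monom (?A \<union> ?B) h = m}"
  define S where "S = Sigma (splits m) (\<lambda>(a, b). compatible_fillings a u \<times> compatible_fillings b v)"
  have split: "filling_monom (?A \<union> ?B) h = filling_monom ?A h + filling_monom ?B h" for h
    unfolding filling_monom_def using disj by (simp add: sum.union_disjoint)
  have "coeff (F_word u * F_word v) m = (\<Sum>(a, b)\<in>splits m. of_nat (card (compatible_fillings a u)) * of_nat (card (compatible_fillings b v)))"
    by (simp add: times_pseries.rep_eq coeff_F_word_card u v)
  also have "\<dots> = of_nat (card S)"
    unfolding S_def using finite_splits finite_compatible_fillings u v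
    by (subst card_SigmaI) (auto simp: card_cartesian_product intro!: sum.cong)
  also have "card S = card J"
  proof (rule bij_betw_same_card[symmetric])
    show "bij_betw (\<lambda>h. ((filling_monom ?A h, filling_monom ?B h), (restrict h ?A, restrict h ?B))) J S"
    proof (rule bij_betw_byWitness[where f' = "\<lambda>(_, (f, g)) x. if x \<in> ?A then f x else g x"])
      show "\<forall>h\<in>J. (case ((filling_monom ?A h, filling_monom ?B h), (restrict h ?A, restrict h ?B)) of
               (_, (f, g)) \<Rightarrow> \<lambda>x. if x \<in> ?A then f x else g x) = h"
        by (auto simp: J_def PiE_iff extensional_def fun_eq_iff)
      show "\<forall>p\<in>S. (\<lambda>h. ((filling_monom ?A h, filling_monom ?B h), (restrict h ?A, restrict h ?B)))
              (case p of (_, (f, g)) \<Rightarrow> \<lambda>x. if x \<in> ?A then f x else g x) = p"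
      proof
        fix p assume "p \<in> S"
        then obtain a b f g where p: "p = ((a, b), (f, g))" "(a, b) \<in> splits m" "f \<in> compatible_fillings a u" "g \<in> compatible_fillings b v"
          by (auto simp: S_def)
        let ?h = "\<lambda>x. if x \<in> ?A then f x else g x"
        have "filling_monom ?A ?h = filling_monom ?A f" by (rule filling_monom_cong) simp
        then have "filling_monom ?A ?h = a" using p by (simp add: compatible_fillings_def)
        moreover have "filling_monom ?B ?h = filling_monom ?B g" by (rule filling_monom_cong) (use disj in auto)
        then have "filling_monom ?B ?h = b" using p by (simp add: compatible_fillings_def)
        moreover have "restrict ?h ?A = f"
          using p by (auto simp: compatible_fillings_def fun_eq_iff PiE_iff extensional_def)
        moreover have "restrict ?h ?B = g"
          using p disj by (auto simp: compatible_fillings_def fun_eq_iff PiE_iff extensional_def)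
        ultimately show "(\<lambda>h. ((filling_monom ?A h, filling_monom ?B h), (restrict h ?A, restrict h ?B)))
              (case p of (_, (f, g)) \<Rightarrow> \<lambda>x. if x \<in> ?A then f x else g x) = p" by (simp add: p)
      qed
      show "(\<lambda>h. ((filling_monom ?A h, filling_monom ?B h), (restrict h ?A, restrict h ?B))) ` J \<subseteq> S"
      proof
        fix p assume "p \<in> (\<lambda>h. ((filling_monom ?A h, filling_monom ?B h), (restrict h ?A, restrict h ?B))) ` J"
        then obtain h where h: "h \<in> J" "p = ((filling_monom ?A h, filling_monom ?B h), (restrict h ?A, restrict h ?B))" by auto
        have "compatible (restrict h ?A) u" "compatible (restrict h ?B) v"
          using h compatible_cong[of u h "restrict h ?A"] compatible_cong[of v h "restrict h ?B"]
          by (auto simp: J_def)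
        moreover have "filling_monom ?A (restrict h ?A) = filling_monom ?A h" "filling_monom ?B (restrict h ?B) = filling_monom ?B h"
          by (auto intro!: filling_monom_cong)
        ultimately show "p \<in> S" using h split[of h] by (auto simp: S_def compatible_fillings_def splits_def J_def)
      qed
      show "(\<lambda>(_, (f, g)) x. if x \<in> ?A then f x else g x) ` S \<subseteq> J"
      proof
        fix h assume "h \<in> (\<lambda>(_, (f, g)) x. if x \<in> ?A then f x else g x) ` S"
        then obtain a b f g where p: "(a, b) \<in> splits m" "f \<in> compatible_fillings a u" "g \<in> compatible_fillings b v"
          and h: "h = (\<lambda>x. if x \<in> ?A then f x else g x)"
          by (auto simp: S_def)
        have hf: "h x = f x" if "x \<in> ?A" for x using that by (simp add: h)
        have hg: "h x = g x" if "x \<in> ?B" for x using that disj by (auto simp: h)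
        have "filling_monom ?A h = a" "filling_monom ?B h = b"
          using p filling_monom_cong[of ?A h f, OF hf] filling_monom_cong[of ?B h g, OF hg] by (simp_all add: compatible_fillings_def)
        moreover have "compatible h u" "compatible h v"
          using p compatible_cong[of u h f, OF hf] compatible_cong[of v h g, OF hg] by (simp_all add: compatible_fillings_def)
        moreover have "h \<in> (?A \<union> ?B) \<rightarrow>\<^sub>E UNIV"
          using p by (auto simp: h compatible_fillings_def PiE_iff extensional_def)
        ultimately show "h \<in> J" using p split[of h] by (auto simp: J_def splits_def)
      qed
    qed
  qed
  \<comment> \<open>A joint filling orders the whole alphabet in one way. Restricting that word to
    either alphabet leaves a compatible word, which by uniqueness is \<open>u\<close> or
    \<open>v\<close>.\<close>
  also have "J = (\<Union>w\<in>word_shuffles u v. compatible_fillings m w)"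
  proof (intro equalityI subsetI)
    fix h assume h: "h \<in> J"
    obtain w where w: "set w = ?A \<union> ?B" "compatible h w" using compatible_exists[of "?A \<union> ?B" h] by auto
    have "filter (\<lambda>x. x \<in> ?A) w = u" "filter (\<lambda>x. x \<in> ?B) w = v"
      using h w by (auto intro!: compatible_unique[of h] compatible_filter simp: J_def)
    then have "w \<in> word_shuffles u v" using w compatible_distinct by (auto simp: word_shuffles_def)
    moreover have "h \<in> compatible_fillings m w" using h w unfolding J_def compatible_fillings_def by (simp only: mem_Collect_eq)
    ultimately show "h \<in> (\<Union>w\<in>word_shuffles u v. compatible_fillings m w)" by blast
  next
    fix h assume "h \<in> (\<Union>w\<in>word_shuffles u v. compatible_fillings m w)"
    then obtain w where w: "w \<in> word_shuffles u v" "h \<in> compatible_fillings m w" by auto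
    then have "compatible h (filter (\<lambda>x. x \<in> ?A) w)" "compatible h (filter (\<lambda>x. x \<in> ?B) w)"
      by (auto intro!: compatible_filter simp only: compatible_fillings_def)
    moreover have "filter (\<lambda>x. x \<in> ?A) w = u" "filter (\<lambda>x. x \<in> ?B) w = v" "set w = ?A \<union> ?B"
      using w by (auto simp only: word_shuffles_def)
    ultimately show "h \<in> J" using w by (simp add: J_def compatible_fillings_def)
  qed
  also have "card \<dots> = (\<Sum>w\<in>word_shuffles u v. card (compatible_fillings m w))"
  proof (rule card_UN_disjoint)
    show "\<forall>w\<in>word_shuffles u v. finite (compatible_fillings m w)" by (auto simp: word_shuffles_def intro: finite_compatible_fillings)
    show "\<forall>w\<in>word_shuffles u v. \<forall>w'\<in>word_shuffles u v. w \<noteq> w' \<longrightarrow> compatible_fillings m w \<inter> compatible_fillings m w' = {}"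
      by (auto simp: compatible_fillings_def word_shuffles_def intro: compatible_unique)
  qed simp
  also have "of_nat \<dots> = coeff (\<Sum>w\<in>word_shuffles u v. F_word w) m"
    unfolding coeff_sum of_nat_sum by (rule sum.cong) (auto simp: coeff_F_word_card word_shuffles_def)
  finally show "coeff (F_word u * F_word v) m = coeff (\<Sum>w\<in>word_shuffles u v. F_word w) m" .
qed

section \<open>Coordinates and the coproduct\<close>

text \<open>For \<beta> = (b_1, b_2, ...) this is the word of x_0^b_1 x_1^b_2 ..., a monomial that
  occurs in \<open>M \<beta>\<close> and in no other \<open>M \<alpha>\<close>.\<close>

definition canonical_indices :: "nat list \<Rightarrow> nat list"
  where "canonical_indices \<beta> = runs \<beta> [0..<length \<beta>]"

text \<open>Reading the coordinate at \<open>M \<beta>\<close> off one monomial makes it linear on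
  all power series; on \<open>QSym\<close> it agrees with \<open>M_coord\<close>.\<close>

definition M_coeff :: "pseries \<Rightarrow> nat list \<Rightarrow> rat"
  where "M_coeff f \<beta> = coeff f (monom_of (canonical_indices \<beta>))"

lemma sorted_canonical_indices: "sorted (canonical_indices \<beta>)" by (simp add: canonical_indices_def sorted_runs)
lemma length_canonical_indices: "length (canonical_indices \<beta>) = sum_list \<beta>" by (simp add: canonical_indices_def length_runs)
lemma rises_canonical_indices: "\<beta> \<in> compositions \<Longrightarrow> rises (canonical_indices \<beta>) = S_of \<beta>" by (simp add: canonical_indices_def rises_runs)

lemma M_coeff_scale: "M_coeff (scale c f) \<beta> = c * M_coeff f \<beta>" by (simp add: M_coeff_def scale.rep_eq)
lemma M_coeff_sum: "M_coeff (\<Sum>x\<in>A. f x) \<beta> = (\<Sum>x\<in>A. M_coeff (f x) \<beta>)" by (simp add: M_coeff_def coeff_sum)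
lemma M_coeff_0 [simp]: "M_coeff 0 \<beta> = 0" by (simp add: M_coeff_def zero_pseries.rep_eq)

lemma M_coeff_M:
  assumes "\<alpha> \<in> compositions" "\<beta> \<in> compositions"
  shows "M_coeff (M \<alpha>) \<beta> = (if \<alpha> = \<beta> then 1 else 0)"
  unfolding M_coeff_def using coeff_M[OF assms(1) sorted_canonical_indices] assms inj_on_S_of[of "sum_list \<alpha>"]
  by (auto simp: length_canonical_indices rises_canonical_indices inj_on_def Comp_def)

lemma M_coeff_F:
  assumes "\<alpha> \<in> compositions" "\<beta> \<in> compositions"
  shows "M_coeff (F \<alpha>) \<beta> = (if sum_list \<alpha> = sum_list \<beta> \<and> S_of \<alpha> \<subseteq> S_of \<beta> then 1 else 0)"
  unfolding M_coeff_def using coeff_F[OF assms(1) sorted_canonical_indices] assms by (auto simp: length_canonical_indices rises_canonical_indices)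

lemma M_coeff_F_word:
  assumes "\<beta> \<in> compositions"
  shows "M_coeff (F_word w) \<beta> = (if sum_list \<beta> = length w \<and> descents w \<subseteq> partial_sums \<beta> then 1 else 0)"
proof -
  have "descents w \<subseteq> S_of \<beta> \<longleftrightarrow> descents w \<subseteq> partial_sums \<beta>" if "sum_list \<beta> = length w"
    using that assms descents_subset[of w] by (intro subset_S_of_iff[of _ "length w"]) (auto simp: Comp_def)
  then show ?thesis unfolding M_coeff_def coeff_F_word[OF sorted_canonical_indices] using assms
    by (auto simp: length_canonical_indices rises_canonical_indices)
qed

text \<open>Ordered by \<open>card (S_of \<alpha>)\<close>, the coordinate matrix is unitriangular.
  In a linear relation, the coordinate at an index of least cardinality among those with nonzero
  coefficient isolates that coefficient. Both \<open>M\<close> and \<open>F\<close> are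
  instances.\<close>

lemma triangular_basis:
  assumes diag: "\<And>\<alpha>. \<alpha> \<in> compositions \<Longrightarrow> M_coeff (B \<alpha>) \<alpha> = 1"
    and tri: "\<And>\<alpha> \<beta>. \<alpha> \<in> compositions \<Longrightarrow> \<beta> \<in> compositions \<Longrightarrow> M_coeff (B \<alpha>) \<beta> \<noteq> 0 \<Longrightarrow>
                 \<alpha> = \<beta> \<or> card (S_of \<alpha>) < card (S_of \<beta>)"
  shows "inj_on B compositions" "pseries.independent (B ` compositions)"
proof -
  show inj: "inj_on B compositions"
  proof (rule inj_onI)
    fix \<alpha> \<beta> assume *: "\<alpha> \<in> compositions" "\<beta> \<in> compositions" "B \<alpha> = B \<beta>"
    then have "M_coeff (B \<alpha>) \<beta> = 1" "M_coeff (B \<beta>) \<alpha> = 1" using diag by metis+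
    then show "\<alpha> = \<beta>" using tri[of \<alpha> \<beta>] tri[of \<beta> \<alpha>] * by auto
  qed
  show "pseries.independent (B ` compositions)"
    unfolding pseries.independent_explicit_module
  proof (intro allI impI, rule ccontr)
    fix t u v
    assume t: "finite t" "t \<subseteq> B ` compositions" "(\<Sum>v\<in>t. scale (u v) v) = 0" "v \<in> t" "u v \<noteq> 0"
    define A where "A = {\<alpha> \<in> compositions. B \<alpha> \<in> t \<and> u (B \<alpha>) \<noteq> 0}"
    have "A \<noteq> {}" using t by (auto simp: A_def)
    then obtain \<alpha> where \<alpha>: "\<alpha> \<in> A" "\<And>\<beta>. \<beta> \<in> A \<Longrightarrow> card (S_of \<alpha>) \<le> card (S_of \<beta>)"
      using ex_has_least_nat[of "\<lambda>\<alpha>. \<alpha> \<in> A" _ "\<lambda>\<alpha>. card (S_of \<alpha>)"] by blast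
    have "u b * M_coeff b \<alpha> = (if b = B \<alpha> then u b else 0)" if b: "b \<in> t" for b
    proof -
      obtain \<beta> where \<beta>: "b = B \<beta>" "\<beta> \<in> compositions" using b t(2) by auto
      show ?thesis
      proof (cases "\<beta> = \<alpha>")
        case True then show ?thesis using \<beta> diag by simp
      next
        case False
        then have ne: "b \<noteq> B \<alpha>" using inj \<beta> \<alpha>(1) by (auto simp: inj_on_def A_def)
        have "u b = 0 \<or> M_coeff b \<alpha> = 0"
        proof (rule ccontr)
          assume "\<not> ?thesis"
          then have "\<beta> \<in> A" "card (S_of \<beta>) < card (S_of \<alpha>)"
            using \<beta> b tri[of \<beta> \<alpha>] False \<alpha>(1) by (auto simp: A_def)
          then show False using \<alpha>(2)[of \<beta>] by simp
        qed
        then show ?thesis using ne by auto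
      qed
    qed
    then have "M_coeff (\<Sum>v\<in>t. scale (u v) v) \<alpha> = (\<Sum>b\<in>t. if b = B \<alpha> then u b else 0)"
      by (simp add: M_coeff_sum M_coeff_scale)
    also have "\<dots> = u (B \<alpha>)" using \<alpha>(1) t(1) by (simp add: A_def)
    finally show False using t(3) \<alpha>(1) by (simp add: A_def)
  qed
qed

lemma inj_on_M: "inj_on M compositions"
  and independent_M: "pseries.independent (M ` compositions)"
  by (rule triangular_basis; auto simp: M_coeff_M split: if_splits)+

lemma inj_on_F: "inj_on F compositions"
  and independent_F: "pseries.independent (F ` compositions)"
proof -
  have tri: "\<alpha> = \<beta> \<or> card (S_of \<alpha>) < card (S_of \<beta>)"
    if "\<alpha> \<in> compositions" "\<beta> \<in> compositions" "M_coeff (F \<alpha>) \<beta> \<noteq> 0" for \<alpha> \<beta>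
  proof -
    have *: "sum_list \<alpha> = sum_list \<beta>" "S_of \<alpha> \<subseteq> S_of \<beta>"
      using that by (auto simp: M_coeff_F split: if_splits)
    have "finite (S_of \<beta>)" using that by (simp add: S_of_eq_partial_sums)
    moreover have "S_of \<alpha> = S_of \<beta> \<Longrightarrow> \<alpha> = \<beta>"
      using * that inj_on_S_of[of "sum_list \<alpha>"] by (auto simp: inj_on_def Comp_def)
    ultimately show ?thesis using *(2) by (metis psubsetI psubset_card_mono)
  qed
  show "inj_on F compositions" "pseries.independent (F ` compositions)"
    by (rule triangular_basis; use tri in \<open>auto simp: M_coeff_F\<close>)+
qed

lemma M_coord_eq_M_coeff:
  assumes "f \<in> QSym" "\<beta> \<in> compositions"
  shows "M_coord f \<beta> = M_coeff f \<beta>"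
proof -
  let ?r = "pseries.representation (M ` compositions) f"
  have fin: "finite {b. ?r b \<noteq> 0}" by (rule pseries.finite_representation)
  have "f = (\<Sum>b | ?r b \<noteq> 0. scale (?r b) b)"
    using pseries.sum_nonzero_representation_eq[OF independent_M] assms(1) by (simp add: QSym_def)
  then have "M_coeff f \<beta> = (\<Sum>b | ?r b \<noteq> 0. ?r b * M_coeff b \<beta>)" by (metis (no_types, lifting) M_coeff_sum M_coeff_scale sum.cong)
  also have "\<dots> = (\<Sum>b | ?r b \<noteq> 0. if b = M \<beta> then ?r b else 0)"
  proof (rule sum.cong)
    fix b assume "b \<in> {b. ?r b \<noteq> 0}"
    then obtain \<alpha> where "b = M \<alpha>" "\<alpha> \<in> compositions"
      using pseries.representation_ne_zero by blast
    then show "?r b * M_coeff b \<beta> = (if b = M \<beta> then ?r b else 0)"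
      using assms(2) inj_on_M by (auto simp: M_coeff_M inj_on_def)
  qed simp
  also have "\<dots> = ?r (M \<beta>)" using fin by simp
  finally show ?thesis by (simp add: M_coord_def)
qed

lemma finite_M_supp: "finite (M_supp f)"
proof (rule finite_imageD)
  show "inj_on M (M_supp f)" using inj_on_M by (rule inj_on_subset) (auto simp: M_supp_def)
  show "finite (M ` M_supp f)"
    by (rule finite_subset[OF _ pseries.finite_representation[of "M ` compositions" f]])
       (auto simp: M_supp_def M_coord_def)
qed

section \<open>Homogeneous components\<close>

lemma Comp_subset: "Comp n \<subseteq> compositions" by (auto simp: Comp_def)

lemma QSym_deg_subset: "QSym_deg n \<subseteq> QSym"
  unfolding QSym_deg_def QSym_def by (intro pseries.span_mono image_mono Comp_subset)

lemma QSym_deg_expand: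
  assumes "f \<in> QSym_deg n"
  shows "f = (\<Sum>\<beta>\<in>Comp n. scale (M_coeff f \<beta>) (M \<beta>))"
proof -
  obtain u where u: "f = (\<Sum>v\<in>M ` Comp n. scale (u v) v)"
    using assms pseries.span_finite[of "M ` Comp n"] by (auto simp: QSym_deg_def)
  have inj: "inj_on M (Comp n)" using inj_on_M Comp_subset by (rule inj_on_subset)
  have f: "f = (\<Sum>\<beta>\<in>Comp n. scale (u (M \<beta>)) (M \<beta>))"
    unfolding u by (simp add: sum.reindex[OF inj])
  have "M_coeff f \<alpha> = u (M \<alpha>)" if "\<alpha> \<in> Comp n" for \<alpha>
  proof -
    have "M_coeff f \<alpha> = (\<Sum>\<beta>\<in>Comp n. u (M \<beta>) * (if \<beta> = \<alpha> then 1 else 0))"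
      unfolding f M_coeff_sum M_coeff_scale
      using that Comp_subset[of n] by (intro sum.cong) (auto simp: M_coeff_M subset_eq)
    then show ?thesis using that by (simp add: if_distrib cong: if_cong)
  qed
  then show ?thesis using f by (metis (no_types, lifting) sum.cong)
qed

lemma QSym_deg_coeff_eq_0:
  assumes "f \<in> QSym_deg n" "length l \<noteq> n"
  shows "coeff f (monom_of l) = 0"
proof -
  have s: "monom_of l = monom_of (sort l)" by (simp add: monom_of_eq_iff)
  have "coeff f (monom_of l) = (\<Sum>\<beta>\<in>Comp n. M_coeff f \<beta> * coeff (M \<beta>) (monom_of l))"
    by (subst QSym_deg_expand[OF assms(1)]) (simp add: coeff_sum scale.rep_eq)
  also have "\<dots> = 0" unfolding s
    by (rule sum.neutral) (use assms(2) in \<open>auto simp: coeff_M Comp_def\<close>)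
  finally show ?thesis .
qed

lemma QSym_deg_eqI:
  assumes "f \<in> QSym_deg n" "g \<in> QSym_deg n" "\<And>\<beta>. \<beta> \<in> Comp n \<Longrightarrow> M_coeff f \<beta> = M_coeff g \<beta>"
  shows "f = g"
proof -
  have "f = (\<Sum>\<beta>\<in>Comp n. scale (M_coeff f \<beta>) (M \<beta>))" using assms(1) by (rule QSym_deg_expand)
  also have "\<dots> = (\<Sum>\<beta>\<in>Comp n. scale (M_coeff g \<beta>) (M \<beta>))" using assms(3) by simp
  also have "\<dots> = g" using QSym_deg_expand[OF assms(2)] by simp
  finally show ?thesis .
qed

lemma M_in_QSym_deg: "\<alpha> \<in> Comp n \<Longrightarrow> M \<alpha> \<in> QSym_deg n"
  unfolding QSym_deg_def by (auto intro: pseries.span_base)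

lemma F_in_QSym_deg: "\<alpha> \<in> Comp n \<Longrightarrow> F \<alpha> \<in> QSym_deg n"
  unfolding F_def QSym_deg_def
  by (rule pseries.span_sum) (auto intro!: pseries.span_base simp: Comp_def)

lemma F_word_in_QSym_deg: "F_word w \<in> QSym_deg (length w)"
  unfolding F_word_def by (rule F_in_QSym_deg) simp

lemma F_word_in_QSym: "F_word w \<in> QSym"
  using F_word_in_QSym_deg QSym_deg_subset by blast

text \<open>The pair \<open>(\<beta>, \<gamma>)\<close> arises from a single deconcatenation, namely
  one of \<open>\<beta> @ \<gamma>\<close>.\<close>

lemma lookup_coproduct:
  assumes "f \<in> QSym"
  shows "Poly_Mapping.lookup (coproduct f) (\<beta>, \<gamma>) = (if \<beta> @ \<gamma> \<in> compositions then M_coeff f (\<beta> @ \<gamma>) else 0)"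
proof -
  have fin: "finite {(\<beta>, \<gamma>). \<beta> @ \<gamma> = (\<alpha> :: nat list)}" for \<alpha>
  proof -
    have "{(\<beta>, \<gamma>). \<beta> @ \<gamma> = \<alpha>} \<subseteq> (\<lambda>i. (take i \<alpha>, drop i \<alpha>)) ` {..length \<alpha>}"
    proof clarify
      fix \<beta> \<gamma> :: "nat list"
      show "(\<beta>, \<gamma>) \<in> (\<lambda>i. (take i (\<beta> @ \<gamma>), drop i (\<beta> @ \<gamma>))) ` {..length (\<beta> @ \<gamma>)}"
        by (rule image_eqI[of _ _ "length \<beta>"]) auto
    qed
    then show ?thesis by (rule finite_subset) simp
  qed
  have "Poly_Mapping.lookup (coproduct f) (\<beta>, \<gamma>) =
      (\<Sum>\<alpha>\<in>M_supp f. \<Sum>p\<in>{(\<beta>, \<gamma>). \<beta> @ \<gamma> = \<alpha>}. if p = (\<beta>, \<gamma>) then M_coord f \<alpha> else 0)"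
    unfolding coproduct_def lookup_sum
    by (intro sum.cong refl) (auto simp: lookup_single when_def)
  also have "\<dots> = (\<Sum>\<alpha>\<in>M_supp f. if \<alpha> = \<beta> @ \<gamma> then M_coord f \<alpha> else 0)"
    using fin by (intro sum.cong refl) auto
  also have "\<dots> = (if \<beta> @ \<gamma> \<in> M_supp f then M_coord f (\<beta> @ \<gamma>) else 0)"
    using finite_M_supp by simp
  also have "\<dots> = (if \<beta> @ \<gamma> \<in> compositions then M_coeff f (\<beta> @ \<gamma>) else 0)"
    using M_coord_eq_M_coeff[OF assms] by (auto simp: M_supp_def)
  finally show ?thesis .
qed

lemma lookup_tensor:
  assumes "f \<in> QSym" "g \<in> QSym" "\<beta> \<in> compositions" "\<gamma> \<in> compositions"
  shows "Poly_Mapping.lookup (tensor f g) (\<beta>, \<gamma>) = M_coeff f \<beta> * M_coeff g \<gamma>"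
proof -
  have "Poly_Mapping.lookup (tensor f g) (\<beta>, \<gamma>) =
      (\<Sum>b\<in>M_supp f. \<Sum>c\<in>M_supp g. if c = \<gamma> then (if b = \<beta> then M_coord f b * M_coord g c else 0) else 0)"
    unfolding tensor_def lookup_sum by (intro sum.cong refl) (auto simp: lookup_single when_def)
  also have "\<dots> = (if \<beta> \<in> M_supp f \<and> \<gamma> \<in> M_supp g then M_coord f \<beta> * M_coord g \<gamma> else 0)"
    using finite_M_supp by (cases "\<gamma> \<in> M_supp g") simp_all
  also have "\<dots> = M_coord f \<beta> * M_coord g \<gamma>"
    using assms by (auto simp: M_supp_def)
  finally show ?thesis using M_coord_eq_M_coeff assms by simp
qed

lemma lookup_map_times:
  "Poly_Mapping.lookup (Poly_Mapping.map (\<lambda>x. c * x) p) k = c * Poly_Mapping.lookup p (k :: 'a)"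
  for c :: rat
  by transfer (auto simp: when_def)

section \<open>Endomorphisms and the coproduct\<close>

locale qsym_end =
  fixes \<Phi> :: "pseries \<Rightarrow> pseries"
  assumes End: "\<Phi> \<in> QSym_End"
begin

lemma deg: "f \<in> QSym_deg n \<Longrightarrow> \<Phi> f \<in> QSym_deg n"
  and add: "f \<in> QSym \<Longrightarrow> g \<in> QSym \<Longrightarrow> \<Phi> (f + g) = \<Phi> f + \<Phi> g"
  and scale: "f \<in> QSym \<Longrightarrow> \<Phi> (scale c f) = scale c (\<Phi> f)"
  and one: "\<Phi> 1 = 1"
  and mult: "f \<in> QSym \<Longrightarrow> g \<in> QSym \<Longrightarrow> \<Phi> (f * g) = \<Phi> f * \<Phi> g"
  and coproduct: "f \<in> QSym \<Longrightarrow> coproduct (\<Phi> f) = tensor_map \<Phi> \<Phi> (coproduct f)"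
  using End by (auto simp: QSym_End_def)

lemma zero: "\<Phi> 0 = 0"
  using scale[of 0 0] by (simp add: QSym_def pseries.span_zero)

lemma sum: "(\<And>x. x \<in> A \<Longrightarrow> f x \<in> QSym) \<Longrightarrow> \<Phi> (\<Sum>x\<in>A. f x) = (\<Sum>x\<in>A. \<Phi> (f x))"
proof (induction A rule: infinite_finite_induct)
  case (insert x A)
  then have "(\<Sum>x\<in>A. f x) \<in> QSym" unfolding QSym_def by (intro pseries.span_sum) auto
  then show ?case using insert by (simp add: add)
qed (auto simp: zero)

lemma M_coeff_image:
  assumes "f \<in> QSym_deg n"
  shows "M_coeff (\<Phi> f) \<beta> = (\<Sum>\<alpha>\<in>Comp n. M_coeff f \<alpha> * M_coeff (\<Phi> (M \<alpha>)) \<beta>)"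
proof -
  have M: "M \<alpha> \<in> QSym" if "\<alpha> \<in> Comp n" for \<alpha>
    using M_in_QSym_deg[OF that] QSym_deg_subset by blast
  then have sM: "scale c (M \<alpha>) \<in> QSym" if "\<alpha> \<in> Comp n" for \<alpha> c
    using that unfolding QSym_def by (auto intro: pseries.span_scale)
  have "\<Phi> f = (\<Sum>\<alpha>\<in>Comp n. scale (M_coeff f \<alpha>) (\<Phi> (M \<alpha>)))"
    by (subst QSym_deg_expand[OF assms]) (simp add: sum sM scale M)
  then show ?thesis by (simp add: M_coeff_sum M_coeff_scale)
qed

text \<open>Both sides of the comultiplicativity of \<open>\<Phi>\<close> are compared at the basis
  pair \<open>(\<beta>, \<gamma>)\<close>. The coordinates of \<open>F_word p\<close> factor at the
  cut, hence so do those of its image.\<close>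

lemma M_coeff_image_F_word_append:
  assumes "\<beta> \<in> Comp b" "\<gamma> \<in> Comp c" "length p = b + c"
  shows "M_coeff (\<Phi> (F_word p)) (\<beta> @ \<gamma>) = M_coeff (\<Phi> (F_word (take b p))) \<beta> * M_coeff (\<Phi> (F_word (drop b p))) \<gamma>"
proof -
  let ?t = "coproduct (F_word p)"
  let ?g = "\<lambda>q. Poly_Mapping.lookup ?t q * (M_coeff (\<Phi> (M (fst q))) \<beta> * M_coeff (\<Phi> (M (snd q))) \<gamma>)"
  have comps: "\<beta> \<in> compositions" "\<gamma> \<in> compositions" "sum_list \<beta> = b" "sum_list \<gamma> = c"
    using assms by (auto simp: Comp_def)
  have PhiM: "\<Phi> (M \<alpha>) \<in> QSym_deg (sum_list \<alpha>)" if "\<alpha> \<in> compositions" for \<alpha>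
    using that by (intro deg M_in_QSym_deg) (simp add: Comp_def)
  have zero: "M_coeff (\<Phi> (M \<alpha>)) \<delta> = 0" if "\<alpha> \<in> compositions" "sum_list \<alpha> \<noteq> sum_list \<delta>" for \<alpha> \<delta>
    unfolding M_coeff_def using PhiM that by (intro QSym_deg_coeff_eq_0) (auto simp: length_canonical_indices)
  have key: "\<beta>' @ \<gamma>' \<in> compositions" if "(\<beta>', \<gamma>') \<in> Poly_Mapping.keys ?t" for \<beta>' \<gamma>'
    using that lookup_coproduct[OF F_word_in_QSym, of p \<beta>' \<gamma>'] by (auto simp: in_keys_iff split: if_splits)
  have "M_coeff (\<Phi> (F_word p)) (\<beta> @ \<gamma>) = Poly_Mapping.lookup (tensor_map \<Phi> \<Phi> ?t) (\<beta>, \<gamma>)"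
  proof -
    have "\<Phi> (F_word p) \<in> QSym" using deg[OF F_word_in_QSym_deg] QSym_deg_subset by blast
    from lookup_coproduct[OF this, of \<beta> \<gamma>] show ?thesis
      using comps coproduct[OF F_word_in_QSym] by simp
  qed
  also have "\<dots> = (\<Sum>q\<in>Poly_Mapping.keys ?t. ?g q)"
    unfolding tensor_map_def lookup_sum
  proof (intro sum.cong refl)
    fix q assume q: "q \<in> Poly_Mapping.keys ?t"
    obtain \<beta>' \<gamma>' where qq: "q = (\<beta>', \<gamma>')" by (cases q)
    then have "\<Phi> (M \<beta>') \<in> QSym" "\<Phi> (M \<gamma>') \<in> QSym"
      using key[of \<beta>' \<gamma>'] q PhiM QSym_deg_subset by auto
    then show "Poly_Mapping.lookup (case q of (\<beta>, \<gamma>) \<Rightarrow> Poly_Mapping.map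
         (\<lambda>x. Poly_Mapping.lookup ?t (\<beta>, \<gamma>) * x) (tensor (\<Phi> (M \<beta>)) (\<Phi> (M \<gamma>)))) (\<beta>, \<gamma>) = ?g q"
      using comps by (simp add: qq lookup_map_times lookup_tensor)
  qed
  \<comment> \<open>As \<open>\<Phi>\<close> preserves degrees, only pairs of bidegree
    \<open>(b, c)\<close> contribute; those outside the support of the coproduct add zeros.\<close>
  also have "\<dots> = (\<Sum>q\<in>Comp b \<times> Comp c. ?g q)"
  proof (rule sum.mono_neutral_cong)
    fix q assume q: "q \<in> Poly_Mapping.keys ?t - Comp b \<times> Comp c"
    obtain \<beta>' \<gamma>' where qq: "q = (\<beta>', \<gamma>')" by (cases q)
    then have "\<beta>' \<in> compositions" "\<gamma>' \<in> compositions" using key[of \<beta>' \<gamma>'] q by auto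
    moreover from this q qq have "sum_list \<beta>' \<noteq> b \<or> sum_list \<gamma>' \<noteq> c" by (auto simp: Comp_def)
    ultimately show "?g q = 0" using zero comps qq by auto
  qed (auto simp: in_keys_iff)
  also have "\<dots> = (\<Sum>q\<in>Comp b \<times> Comp c.
      (M_coeff (F_word (take b p)) (fst q) * M_coeff (\<Phi> (M (fst q))) \<beta>) * (M_coeff (F_word (drop b p)) (snd q) * M_coeff (\<Phi> (M (snd q))) \<gamma>))"
  proof (rule sum.cong[OF refl])
    fix q assume "q \<in> Comp b \<times> Comp c"
    then obtain \<beta>' \<gamma>' where q: "q = (\<beta>', \<gamma>')" "\<beta>' \<in> Comp b" "\<gamma>' \<in> Comp c" by auto
    then have c: "\<beta>' \<in> compositions" "\<gamma>' \<in> compositions" "sum_list \<beta>' = b" "sum_list \<gamma>' = c"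
      by (auto simp: Comp_def)
    have "Poly_Mapping.lookup ?t q = M_coeff (F_word p) (\<beta>' @ \<gamma>')"
      using c q lookup_coproduct[OF F_word_in_QSym] by simp
    \<comment> \<open>The descent condition splits at the cut, because \<open>b\<close> is a partial
      sum of \<open>\<beta>' @ \<gamma>'\<close>.\<close>
    also have "\<dots> = M_coeff (F_word (take b p)) \<beta>' * M_coeff (F_word (drop b p)) \<gamma>'"
      using c assms(3) descents_subset_partial_sums_append_iff[of \<beta>' p \<gamma>'] by (simp add: M_coeff_F_word)
    finally show "?g q = (M_coeff (F_word (take b p)) (fst q) * M_coeff (\<Phi> (M (fst q))) \<beta>) *
        (M_coeff (F_word (drop b p)) (snd q) * M_coeff (\<Phi> (M (snd q))) \<gamma>)" using q by simp
  qed
  also have "\<dots> = (\<Sum>\<beta>'\<in>Comp b. M_coeff (F_word (take b p)) \<beta>' * M_coeff (\<Phi> (M \<beta>')) \<beta>) *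
                  (\<Sum>\<gamma>'\<in>Comp c. M_coeff (F_word (drop b p)) \<gamma>' * M_coeff (\<Phi> (M \<gamma>')) \<gamma>)"
    by (simp add: sum_product sum.cartesian_product split_def)
  also have "\<dots> = M_coeff (\<Phi> (F_word (take b p))) \<beta> * M_coeff (\<Phi> (F_word (drop b p))) \<gamma>"
  proof -
    have "F_word (take b p) \<in> QSym_deg b" "F_word (drop b p) \<in> QSym_deg c"
      using F_word_in_QSym_deg[of "take b p"] F_word_in_QSym_deg[of "drop b p"] assms(3) by simp_all
    then show ?thesis using M_coeff_image by simp
  qed
  finally show ?thesis .
qed

end

section \<open>The matrix of an endomorphism\<close>

definition position :: "nat list \<Rightarrow> nat \<Rightarrow> nat"
  where "position w x = length (takeWhile (\<lambda>z. z \<noteq> x) w)"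

lemma position_less_length: "x \<in> set w \<Longrightarrow> position w x < length w"
  unfolding position_def by (induction w) auto

lemma nth_position: "x \<in> set w \<Longrightarrow> w ! position w x = x"
  using nth_length_takeWhile[of "\<lambda>z. z \<noteq> x" w] position_less_length[of x w] by (simp add: position_def)

lemma position_nth: "distinct w \<Longrightarrow> i < length w \<Longrightarrow> position w (w ! i) = i"
  by (metis nth_eq_iff_index_eq nth_mem nth_position position_less_length)

lemma inj_on_position: "inj_on (position w) (set w)"
  by (metis inj_onI nth_position)

lemma sorted_wrt_position: "distinct w \<Longrightarrow> sorted_wrt (\<lambda>x y. position w x < position w y) w"
  by (simp add: sorted_wrt_iff_nth_less position_nth)

lemma position_filter:
  assumes "distinct w" "x \<in> set w" "y \<in> set w" "P x" "P y"
  shows "position (filter P w) x < position (filter P w) y \<longleftrightarrow> position w x < position w y"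
proof -
  let ?f = "filter P w"
  have s: "sorted_wrt (\<lambda>x y. position w x < position w y) ?f"
    using assms(1) by (intro sorted_wrt_filter sorted_wrt_position)
  have mono: "position w a < position w b" if "a \<in> set ?f" "b \<in> set ?f" "position ?f a < position ?f b" for a b
    using sorted_wrt_nth_less[OF s that(3) position_less_length[OF that(2)]] nth_position that by simp
  have xy: "x \<in> set ?f" "y \<in> set ?f" using assms by auto
  have "position ?f x = position ?f y \<Longrightarrow> x = y" using xy inj_on_position[of ?f] by (auto simp: inj_on_def)
  then show ?thesis using mono[OF xy] mono[OF xy(2,1)] by fastforce
qed

lemma descents_empty_iff: "descents l = {} \<longleftrightarrow> sorted l"
proof
  assume *: "descents l = {}"
  show "sorted l" unfolding sorted_iff_nth_Suc
  proof (intro allI impI)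
    fix i assume "Suc i < length l"
    moreover from * have "Suc i \<notin> descents l" by simp
    ultimately show "l ! i \<le> l ! Suc i" by (simp add: descents_def)
  qed
next
  assume "sorted l"
  then have "l ! (i - 1) \<le> l ! i" if "i < length l" for i
    using that by (intro sorted_nth_mono) auto
  then show "descents l = {}" by (fastforce simp: descents_def)
qed

lemma descents_map_cong:
  assumes "\<And>x y. x \<in> set v \<Longrightarrow> y \<in> set v \<Longrightarrow> f x < f y \<longleftrightarrow> g x < g y"
  shows "descents (map f v) = descents (map g v)"
  unfolding descents_def using assms by (auto simp: less_imp_diff_less)

text \<open>Absence of descents means that the letters of \<open>u\<close> occur in \<open>w\<close>
  from left to right in the order of \<open>u\<close>; the restriction of \<open>w\<close> to these
  letters records just this order.\<close>

lemma descents_map_position_empty_iff: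
  assumes "distinct w" "distinct u" "set u \<subseteq> set w"
  shows "descents (map (position w) u) = {} \<longleftrightarrow> filter (\<lambda>x. x \<in> set u) w = u"
proof -
  have "inj_on (position w) (set u)" using inj_on_position assms(3) by (rule inj_on_subset)
  then have "distinct (map (position w) u)" using assms(2) by (simp add: distinct_map)
  then have "descents (map (position w) u) = {} \<longleftrightarrow> sorted_wrt (<) (map (position w) u)"
    using strict_sorted_iff[of "map (position w) u"] by (simp add: descents_empty_iff del: sorted_wrt_map)
  also have "\<dots> \<longleftrightarrow> sorted_wrt (\<lambda>x y. position w x < position w y) u" by (simp add: sorted_wrt_map)
  also have "\<dots> \<longleftrightarrow> filter (\<lambda>x. x \<in> set u) w = u"
  proof
    assume "sorted_wrt (\<lambda>x y. position w x < position w y) u"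
    then show "filter (\<lambda>x. x \<in> set u) w = u"
      using assms by (intro sorted_wrt_unique[OF sorted_wrt_filter[OF sorted_wrt_position]]) auto
  next
    assume "filter (\<lambda>x. x \<in> set u) w = u"
    then show "sorted_wrt (\<lambda>x y. position w x < position w y) u"
      by (metis sorted_wrt_filter sorted_wrt_position assms(1))
  qed
  finally show ?thesis .
qed

text \<open>A rearrangement \<open>w\<close> of \<open>p\<close> is a shuffle of the consecutive factors of \<open>p\<close> of lengths \<open>\<beta>\<close> iff the
  positions in \<open>w\<close> of the letters of \<open>p\<close> increase along each factor.\<close>

definition rearrangements :: "nat list \<Rightarrow> nat list set"
  where "rearrangements p = {w. distinct w \<and> set w = set p}"

definition block_shuffles :: "nat list \<Rightarrow> nat list \<Rightarrow> nat list set"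
  where "block_shuffles p \<beta> = {w \<in> rearrangements p. descents (map (position w) p) \<subseteq> partial_sums \<beta>}"

lemma finite_rearrangements [simp]: "finite (rearrangements p)"
  unfolding rearrangements_def by (rule finite_distinct_lists) simp

lemma finite_block_shuffles [simp]: "finite (block_shuffles p \<beta>)"
  by (rule finite_subset[OF _ finite_rearrangements[of p]]) (auto simp: block_shuffles_def)

text \<open>The condition on \<open>w\<close> splits after the first \<open>b\<close> letters of
  \<open>p\<close>: the first factor must appear in order, and the restriction of \<open>w\<close>
  to the other letters must be a block shuffle for \<open>\<beta>\<close>.\<close>

lemma block_shuffles_Cons:
  assumes "distinct p" "b + sum_list \<beta> = length p"
  shows "block_shuffles p (b # \<beta>) = (\<Union>v\<in>block_shuffles (drop b p) \<beta>. word_shuffles (take b p) v)"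
proof -
  let ?u = "take b p" and ?v = "drop b p"
  have set: "set p = set ?u \<union> set ?v" by (metis append_take_drop_id set_append)
  have disj: "set ?u \<inter> set ?v = {}" using assms(1) by (simp add: set_take_disj_set_drop_if_distinct)
  have key: "descents (map (position w) p) \<subseteq> partial_sums (b # \<beta>) \<longleftrightarrow>
      filter (\<lambda>x. x \<in> set ?u) w = ?u \<and> descents (map (position (filter (\<lambda>x. x \<in> set ?v) w)) ?v) \<subseteq> partial_sums \<beta>"
    if w: "w \<in> rearrangements p" for w
  proof -
    have "descents (map (position w) p) \<subseteq> partial_sums ([b] @ \<beta>) \<longleftrightarrow>
        descents (map (position w) ?u) \<subseteq> partial_sums [b] \<and> descents (map (position w) ?v) \<subseteq> partial_sums \<beta>"
      using descents_subset_partial_sums_append_iff[of "[b]" "map (position w) p" \<beta>] assms(2)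
      by (simp add: take_map drop_map)
    \<comment> \<open>The partial sums of \<open>[b]\<close> are 0 and \<open>b\<close>, neither of
      which can be a descent of a word of length \<open>b\<close>.\<close>
    moreover have "descents (map (position w) ?u) \<subseteq> partial_sums [b] \<longleftrightarrow> descents (map (position w) ?u) = {}"
      using descents_subset[of "map (position w) ?u"] assms(2) by (fastforce simp: partial_sums_Cons)
    moreover have "descents (map (position w) ?u) = {} \<longleftrightarrow> filter (\<lambda>x. x \<in> set ?u) w = ?u"
      using w assms(1) set by (intro descents_map_position_empty_iff) (auto simp: rearrangements_def)
    moreover have "descents (map (position (filter (\<lambda>x. x \<in> set ?v) w)) ?v) = descents (map (position w) ?v)"
      using w set by (intro descents_map_cong position_filter) (auto simp: rearrangements_def)
    ultimately show ?thesis by simp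
  qed
  show ?thesis
  proof (intro equalityI subsetI)
    fix w assume w: "w \<in> block_shuffles p (b # \<beta>)"
    define v where "v = filter (\<lambda>x. x \<in> set ?v) w"
    have "w \<in> rearrangements p" using w by (simp add: block_shuffles_def)
    with w key have *: "filter (\<lambda>x. x \<in> set ?u) w = ?u" "descents (map (position v) ?v) \<subseteq> partial_sums \<beta>"
      by (auto simp: block_shuffles_def v_def)
    have v: "set v = set ?v" "distinct v" using \<open>w \<in> rearrangements p\<close> set by (auto simp: v_def rearrangements_def)
    then have "v \<in> block_shuffles ?v \<beta>" using * by (simp add: block_shuffles_def rearrangements_def)
    moreover have "filter (\<lambda>x. x \<in> set v) w = v" unfolding v(1) by (simp add: v_def)
    then have "w \<in> word_shuffles ?u v" using * v \<open>w \<in> rearrangements p\<close> set by (simp add: word_shuffles_def rearrangements_def)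
    ultimately show "w \<in> (\<Union>v\<in>block_shuffles ?v \<beta>. word_shuffles ?u v)" by blast
  next
    fix w assume "w \<in> (\<Union>v\<in>block_shuffles ?v \<beta>. word_shuffles ?u v)"
    then obtain v where v: "v \<in> block_shuffles ?v \<beta>" "w \<in> word_shuffles ?u v" by blast
    then have sv: "set v = set ?v" "descents (map (position v) ?v) \<subseteq> partial_sums \<beta>" by (auto simp: block_shuffles_def rearrangements_def)
    have w: "distinct w" "set w = set ?u \<union> set v" "filter (\<lambda>x. x \<in> set ?u) w = ?u"
      "filter (\<lambda>x. x \<in> set v) w = v" using v(2) by (auto simp only: word_shuffles_def mem_Collect_eq)
    then have "w \<in> rearrangements p" using sv set by (simp add: rearrangements_def)
    moreover have "descents (map (position w) p) \<subseteq> partial_sums (b # \<beta>)"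
      unfolding key[OF \<open>w \<in> rearrangements p\<close>] using w(3,4) sv by simp
    ultimately show "w \<in> block_shuffles p (b # \<beta>)" by (simp add: block_shuffles_def)
  qed
qed

text \<open>A power of x_0 factors only into powers of x_0, and homogeneity fixes their exponents.
  This is the multiplicativity of the canonical character of the quasisymmetric functions.\<close>

lemma coeff_mult_pure_power:
  assumes f: "f \<in> QSym_deg a" and g: "g \<in> QSym_deg b"
  shows "coeff (f * g) (monom_of (replicate (a + b) 0)) =
           coeff f (monom_of (replicate a 0)) * coeff g (monom_of (replicate b 0))"
proof -
  let ?p = "(monom_of (replicate a 0), monom_of (replicate b 0))"
  let ?S = "splits (monom_of (replicate (a + b) 0))"
  have "?p \<in> ?S" by (simp add: splits_def monom_of_append[symmetric] replicate_add)
  have "coeff f c * coeff g d = 0" if cd: "(c, d) \<in> ?S" "(c, d) \<noteq> ?p" for c d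
  proof -
    obtain l where l: "c = monom_of l" by (rule monom_of_surj)
    obtain l' where l': "d = monom_of l'" by (rule monom_of_surj)
    have "monom_of (l @ l') = monom_of (replicate (a + b) 0)" using cd(1) l l' by (simp add: splits_def monom_of_append)
    then have ms: "mset (l @ l') = mset (replicate (a + b) 0)" by (simp only: monom_of_eq_iff)
    then have set: "set (l @ l') \<subseteq> {0}" by (metis mset_eq_setD set_replicate_conv_if empty_subsetI order_refl)
    have rep: "l = replicate (length l) 0" "l' = replicate (length l') 0"
      using set by (auto intro!: replicate_length_same[symmetric])
    then have "length l \<noteq> a \<or> length l' \<noteq> b" using cd(2) l l' by auto
    then show ?thesis using QSym_deg_coeff_eq_0[OF f, of l] QSym_deg_coeff_eq_0[OF g, of l'] l l' by auto
  qed
  then have "(\<Sum>(c, d)\<in>?S. coeff f c * coeff g d) = (\<Sum>(c, d)\<in>{?p}. coeff f c * coeff g d)"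
    using \<open>?p \<in> ?S\<close> finite_splits by (intro sum.mono_neutral_right) (blast | clarify)+
  then show ?thesis by (simp add: times_pseries.rep_eq)
qed

lemma Comp_1: "Comp 1 = {[1]}"
proof -
  have "[1] \<in> Comp 1" by (simp add: Comp_def)
  moreover have "\<alpha> = [1]" if "\<alpha> \<in> Comp 1" for \<alpha>
    using inj_on_S_of[of 1] S_of_subset[OF that] S_of_subset[OF \<open>[1] \<in> Comp 1\<close>] that \<open>[1] \<in> Comp 1\<close>
    by (auto simp: inj_on_def)
  ultimately show ?thesis by blast
qed

lemma one_part_in_Comp: "one_part n \<in> Comp n"
  by (simp add: one_part_def Comp_def)

lemma S_of_one_part: "S_of (one_part n) = {}"
  by (auto simp: one_part_def S_of_def)

section \<open>The character attached to an endomorphism\<close>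

context qsym_end
begin

text \<open>This is \<chi>. The coefficient of x_0^n represents the coordinate at
  \<open>one_part n\<close> uniformly, including n = 0.\<close>

definition char_val :: "nat list \<Rightarrow> rat"
  where "char_val w = coeff (\<Phi> (F_word w)) (monom_of (replicate (length w) 0))"

lemma char_val_mult:
  assumes "distinct u" "distinct v" "set u \<inter> set v = {}"
  shows "char_val u * char_val v = (\<Sum>w\<in>word_shuffles u v. char_val w)"
proof -
  have len: "length w = length u + length v" if "w \<in> word_shuffles u v" for w
    using that assms by (metis (mono_tags, lifting) word_shuffles_def card_Un_disjoint distinct_card
        finite_set mem_Collect_eq)
  have "char_val u * char_val v = coeff (\<Phi> (F_word u) * \<Phi> (F_word v)) (monom_of (replicate (length u + length v) 0))"
    unfolding char_val_def by (rule coeff_mult_pure_power[symmetric]) (intro deg F_word_in_QSym_deg)+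
  also have "\<Phi> (F_word u) * \<Phi> (F_word v) = \<Phi> (F_word u * F_word v)" by (simp add: mult F_word_in_QSym)
  also have "\<dots> = (\<Sum>w\<in>word_shuffles u v. \<Phi> (F_word w))" by (simp add: F_word_mult[OF assms] sum F_word_in_QSym)
  finally show ?thesis by (simp add: coeff_sum char_val_def len)
qed

lemma M_coeff_one_part: "length u = b \<Longrightarrow> M_coeff (\<Phi> (F_word u)) [b] = char_val u"
  by (simp add: M_coeff_def char_val_def canonical_indices_def)

text \<open>Comultiplicativity splits off the first factor as a value of the character, induction
  treats the rest, and multiplicativity turns the product into a sum over shuffles.\<close>

lemma M_coeff_image_F_word:
  assumes "distinct p" "\<beta> \<in> Comp (length p)"
  shows "M_coeff (\<Phi> (F_word p)) \<beta> = (\<Sum>w\<in>block_shuffles p \<beta>. char_val w)"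
  using assms
proof (induction \<beta> arbitrary: p)
  case Nil
  then have p: "p = []" by (simp add: Comp_def)
  then have "block_shuffles p [] = {[]}" by (auto simp: block_shuffles_def rearrangements_def descents_def)
  then show ?case using p by (simp add: M_coeff_def char_val_def canonical_indices_def)
next
  case (Cons b \<beta>)
  let ?u = "take b p" and ?v = "drop b p"
  have b: "0 < b" "\<beta> \<in> compositions" "b + sum_list \<beta> = length p" using Cons.prems by (auto simp: Comp_def)
  have disj: "set ?u \<inter> set ?v = {}"
    using Cons.prems(1) by (simp add: set_take_disj_set_drop_if_distinct)
  have "M_coeff (\<Phi> (F_word p)) ([b] @ \<beta>) = M_coeff (\<Phi> (F_word ?u)) [b] * M_coeff (\<Phi> (F_word ?v)) \<beta>"
    using b by (intro M_coeff_image_F_word_append[where c = "sum_list \<beta>"]) (auto simp: Comp_def)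
  also have "M_coeff (\<Phi> (F_word ?u)) [b] = char_val ?u" using b by (intro M_coeff_one_part) simp
  also have "M_coeff (\<Phi> (F_word ?v)) \<beta> = (\<Sum>v\<in>block_shuffles ?v \<beta>. char_val v)"
    using Cons.prems b by (intro Cons.IH) (auto simp: Comp_def)
  also have "char_val ?u * \<dots> = (\<Sum>v\<in>block_shuffles ?v \<beta>. \<Sum>w\<in>word_shuffles ?u v. char_val w)"
    unfolding sum_distrib_left
    using Cons.prems(1) disj by (intro sum.cong char_val_mult) (auto simp: block_shuffles_def rearrangements_def)
  also have "\<dots> = (\<Sum>w\<in>block_shuffles p (b # \<beta>). char_val w)"
    unfolding block_shuffles_Cons[OF Cons.prems(1) b(3)]
  proof (rule sum.UNION_disjoint[symmetric])
    \<comment> \<open>All candidates \<open>v\<close> have the same letters, so \<open>w\<close>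
      determines \<open>v\<close> as its restriction to them and no shuffle is counted
      twice.\<close>
    show "\<forall>v\<in>block_shuffles ?v \<beta>. \<forall>v'\<in>block_shuffles ?v \<beta>. v \<noteq> v' \<longrightarrow> word_shuffles ?u v \<inter> word_shuffles ?u v' = {}"
    proof (intro ballI impI, rule ccontr)
      fix v v' assume *: "v \<in> block_shuffles ?v \<beta>" "v' \<in> block_shuffles ?v \<beta>" "v \<noteq> v'" "word_shuffles ?u v \<inter> word_shuffles ?u v' \<noteq> {}"
      then obtain w where "filter (\<lambda>x. x \<in> set v) w = v" "filter (\<lambda>x. x \<in> set v') w = v'"
        by (auto simp only: word_shuffles_def)
      moreover have "set v = set v'" using * by (auto simp only: block_shuffles_def rearrangements_def mem_Collect_eq)
      ultimately show False using *(3) by simp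
    qed
  qed simp_all
  finally show ?case by simp
qed

text \<open>The word \<open>map (position w) p\<close> spells \<open>p\<close> in the order of
  letters given by \<open>w\<close>; for the one-line words of \<pi> and \<sigma> in place of
  \<open>p\<close> and \<open>w\<close>, its descents are those of
  \<open>inv \<sigma> \<circ> \<pi>\<close>.\<close>

definition F_matrix :: "nat list \<Rightarrow> nat list \<Rightarrow> rat"
  where "F_matrix p \<gamma> = (\<Sum>w | w \<in> rearrangements p \<and> co (length p) (descents (map (position w) p)) = \<gamma>. char_val w)"

lemma descents_map_subset: "descents (map f p) \<subseteq> {1..<length p}"
  using descents_subset[of "map f p"] by simp

text \<open>Comparing coordinates in the basis \<open>M\<close> suffices. There the entries
  \<open>F_matrix p \<gamma>\<close> with \<gamma> coarser than or equal to \<beta> add up to the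
  sum over \<open>block_shuffles p \<beta>\<close>, so the Moebius inversion is verified rather than
  carried out.\<close>

lemma image_F_word:
  assumes "distinct p"
  shows "\<Phi> (F_word p) = (\<Sum>\<gamma>\<in>Comp (length p). scale (F_matrix p \<gamma>) (F \<gamma>))"
proof (rule QSym_deg_eqI)
  let ?n = "length p"
  let ?c = "\<lambda>w. co ?n (descents (map (position w) p))"
  show "\<Phi> (F_word p) \<in> QSym_deg ?n" by (intro deg F_word_in_QSym_deg)
  show "(\<Sum>\<gamma>\<in>Comp ?n. scale (F_matrix p \<gamma>) (F \<gamma>)) \<in> QSym_deg ?n"
    using F_in_QSym_deg unfolding QSym_deg_def by (intro pseries.span_sum pseries.span_scale) auto
  fix \<beta> assume \<beta>: "\<beta> \<in> Comp ?n"
  then have \<beta>': "\<beta> \<in> compositions" "sum_list \<beta> = ?n" by (auto simp: Comp_def)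
  have "M_coeff (\<Sum>\<gamma>\<in>Comp ?n. scale (F_matrix p \<gamma>) (F \<gamma>)) \<beta> =
      (\<Sum>\<gamma>\<in>Comp ?n. \<Sum>w\<in>rearrangements p. if \<gamma> = ?c w then (if S_of \<gamma> \<subseteq> S_of \<beta> then char_val w else 0) else 0)"
    unfolding M_coeff_sum M_coeff_scale
  proof (intro sum.cong refl)
    fix \<gamma> assume "\<gamma> \<in> Comp ?n"
    then have F: "M_coeff (F \<gamma>) \<beta> = (if S_of \<gamma> \<subseteq> S_of \<beta> then 1 else 0)"
      using \<beta>' by (simp add: Comp_def M_coeff_F)
    have "F_matrix p \<gamma> = (\<Sum>w\<in>rearrangements p. if \<gamma> = ?c w then char_val w else 0)"
      unfolding F_matrix_def by (subst sum.inter_filter[symmetric]) (auto intro: sum.cong)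
    then show "F_matrix p \<gamma> * M_coeff (F \<gamma>) \<beta> =
        (\<Sum>w\<in>rearrangements p. if \<gamma> = ?c w then (if S_of \<gamma> \<subseteq> S_of \<beta> then char_val w else 0) else 0)"
      unfolding F by (cases "S_of \<gamma> \<subseteq> S_of \<beta>") (auto intro!: sum.cong sum.neutral)
  qed
  also have "\<dots> = (\<Sum>w\<in>rearrangements p. \<Sum>\<gamma>\<in>Comp ?n.
      if \<gamma> = ?c w then (if S_of \<gamma> \<subseteq> S_of \<beta> then char_val w else 0) else 0)" by (rule sum.swap)
  \<comment> \<open>Each \<open>w\<close> belongs to exactly one \<gamma>, so the inner sum has at
    most one nonzero term.\<close>
  also have "\<dots> = (\<Sum>w\<in>rearrangements p. if descents (map (position w) p) \<subseteq> partial_sums \<beta> then char_val w else 0)"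
  proof (intro sum.cong refl)
    fix w
    show "(\<Sum>\<gamma>\<in>Comp ?n. if \<gamma> = ?c w then (if S_of \<gamma> \<subseteq> S_of \<beta> then char_val w else 0) else 0) =
        (if descents (map (position w) p) \<subseteq> partial_sums \<beta> then char_val w else 0)"
      using co_in_Comp[OF descents_map_subset[of "position w" p]] S_of_co[OF descents_map_subset[of "position w" p]]
        subset_S_of_iff[OF \<beta> descents_map_subset[of "position w" p]] by simp
  qed
  also have "\<dots> = (\<Sum>w\<in>block_shuffles p \<beta>. char_val w)"
    unfolding block_shuffles_def by (rule sum.inter_filter[symmetric]) simp
  finally show "M_coeff (\<Phi> (F_word p)) \<beta> = M_coeff (\<Sum>\<gamma>\<in>Comp ?n. scale (F_matrix p \<gamma>) (F \<gamma>)) \<beta>"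
    using M_coeff_image_F_word[OF assms \<beta>] by simp
qed

lemma F_coeff_eq_F_matrix:
  assumes "distinct p" "\<gamma> \<in> Comp (length p)"
  shows "F_coeff \<Phi> (co (length p) (descents p)) \<gamma> = F_matrix p \<gamma>"
proof -
  have sp: "F \<delta> \<in> pseries.span (F ` compositions)" if "\<delta> \<in> Comp (length p)" for \<delta>
    using that by (auto intro!: pseries.span_base simp: Comp_def)
  have "F_coeff \<Phi> (co (length p) (descents p)) \<gamma> =
      pseries.representation (F ` compositions) (\<Phi> (F_word p)) (F \<gamma>)" by (simp add: F_coeff_def F_word_def)
  also have "\<dots> = (\<Sum>\<delta>\<in>Comp (length p). pseries.representation (F ` compositions) (scale (F_matrix p \<delta>) (F \<delta>)) (F \<gamma>))"
    unfolding image_F_word[OF assms(1)]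
    by (subst pseries.representation_sum[OF independent_F]) (auto intro!: pseries.span_scale sp)
  also have "\<dots> = (\<Sum>\<delta>\<in>Comp (length p). if \<delta> = \<gamma> then F_matrix p \<delta> else 0)"
  proof (intro sum.cong refl)
    fix \<delta> assume \<delta>: "\<delta> \<in> Comp (length p)"
    then have "F \<delta> \<in> F ` compositions" by (auto simp: Comp_def)
    then have "pseries.representation (F ` compositions) (scale (F_matrix p \<delta>) (F \<delta>)) (F \<gamma>) =
        F_matrix p \<delta> * (if F \<gamma> = F \<delta> then 1 else 0)"
      by (simp add: pseries.representation_scale[OF independent_F sp[OF \<delta>]]
          pseries.representation_basis[OF independent_F])
    moreover have "F \<gamma> = F \<delta> \<longleftrightarrow> \<gamma> = \<delta>"
      using inj_on_F \<delta> assms(2) by (auto simp: inj_on_def Comp_def)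
    ultimately show "pseries.representation (F ` compositions) (scale (F_matrix p \<delta>) (F \<delta>)) (F \<gamma>) =
        (if \<delta> = \<gamma> then F_matrix p \<delta> else 0)" by auto
  qed
  also have "\<dots> = F_matrix p \<gamma>" using assms(2) by simp
  finally show ?thesis .
qed

lemma F_coeff_one_part:
  assumes "distinct p"
  shows "F_coeff \<Phi> (co (length p) (descents p)) (one_part (length p)) = char_val p"
proof -
  \<comment> \<open>The one-part composition allows no descents, which forces the letters of
    \<open>w\<close> into the order of \<open>p\<close>.\<close>
  have "co (length p) (descents (map (position w) p)) = one_part (length p) \<longleftrightarrow> w = p" if w: "w \<in> rearrangements p" for w
  proof -
    have "co (length p) (descents (map (position w) p)) = one_part (length p) \<longleftrightarrow> descents (map (position w) p) = {}"
      using S_of_co[OF descents_map_subset[of "position w" p]] co_S_of[OF one_part_in_Comp, of "length p"]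
        S_of_one_part[of "length p"] by metis
    also have "\<dots> \<longleftrightarrow> filter (\<lambda>x. x \<in> set p) w = p"
      using w assms by (intro descents_map_position_empty_iff) (auto simp: rearrangements_def)
    also have "filter (\<lambda>x. x \<in> set p) w = w" using w by (auto simp: rearrangements_def intro: filter_True)
    finally show ?thesis .
  qed
  then have "{w. w \<in> rearrangements p \<and> co (length p) (descents (map (position w) p)) = one_part (length p)} = {p}"
    using assms by (auto simp: rearrangements_def)
  then show ?thesis using F_coeff_eq_F_matrix[OF assms one_part_in_Comp] by (simp add: F_matrix_def)
qed

text \<open>The letter is arbitrary because a one-letter word has no descents:
  \<open>F_word [x]\<close> is always \<open>M [1]\<close>, which spans the component of degree
  one.\<close>

lemma lam_eq_char_val: "lam \<Phi> = char_val [x]"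
proof -
  have "co 1 (descents [x]) \<in> Comp 1" using co_descents_in_Comp[of "[x]"] by simp
  then have "co 1 (descents [x]) = [1]" unfolding Comp_1 by blast
  then have "F_word [x] = F [1]" by (simp add: F_word_def)
  also have "\<dots> = M [1]" 
  proof -
    have "{\<beta> \<in> Comp (sum_list [1]). S_of [1] \<subseteq> S_of \<beta>} = {[1]}" using Comp_1 by auto
    then show ?thesis unfolding F_def by simp
  qed
  finally have FM: "F_word [x] = M [1]" .
  have "\<Phi> (M [1]) \<in> QSym_deg 1" using Comp_1 by (intro deg M_in_QSym_deg) simp
  from QSym_deg_expand[OF this] have "\<Phi> (M [1]) = scale (M_coeff (\<Phi> (M [1])) [1]) (M [1])"
    by (simp add: Comp_1 del: One_nat_def)
  also have "M_coeff (\<Phi> (M [1])) [1] = char_val [x]" using M_coeff_one_part[of "[x]" 1] by (simp add: FM)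
  finally have eq: "\<Phi> (M [1]) = scale (char_val [x]) (M [1])" .
  have "l = char_val [x]" if "\<Phi> (M [1]) = scale l (M [1])" for l
  proof -
    have "M_coeff (scale l (M [1])) [1] = M_coeff (scale (char_val [x]) (M [1])) [1]" using that eq by metis
    then show ?thesis by (simp add: M_coeff_scale M_coeff_M)
  qed
  with eq show ?thesis unfolding lam_def by (intro the_equality)
qed

text \<open>The coordinate at (1^n) is evaluated in two ways: splitting off single letters gives the
  power of \<open>lam \<Phi>\<close>, and the shuffle formula gives the sum over all
  rearrangements.\<close>

lemma sum_char_val:
  assumes "distinct p"
  shows "(\<Sum>w\<in>rearrangements p. char_val w) = lam \<Phi> ^ length p"
proof -
  let ?ones = "\<lambda>n. replicate n (1::nat)"
  have "M_coeff (\<Phi> (F_word p)) (?ones n) = lam \<Phi> ^ n" if "length p = n" for n p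
    using that
  proof (induction n arbitrary: p)
    case 0
    have "F_word [] = 1"
    proof (rule pseries_eqI)
      fix m obtain l where "sorted l" "m = monom_of l" by (rule monom_of_surj)
      then show "coeff (F_word []) m = coeff 1 m"
        using coeff_F_word[of l "[]"] monom_of_sorted_inj[of l "[]"] by (auto simp: one_pseries.rep_eq descents_def)
    qed
    then show ?case using 0 by (simp add: one M_coeff_def canonical_indices_def one_pseries.rep_eq)
  next
    case (Suc n)
    have "M_coeff (\<Phi> (F_word p)) ([1] @ ?ones n) = M_coeff (\<Phi> (F_word (take 1 p))) [1] * M_coeff (\<Phi> (F_word (drop 1 p))) (?ones n)"
      using Suc.prems by (intro M_coeff_image_F_word_append[where c = n]) (auto simp: Comp_def compositions_def sum_list_replicate)
    also have "M_coeff (\<Phi> (F_word (take 1 p))) [1] = lam \<Phi>"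
    proof -
      obtain x q where "p = x # q" using Suc.prems by (cases p) auto
      then show ?thesis using M_coeff_one_part[of "[x]" 1] lam_eq_char_val[of x] by simp
    qed
    also have "M_coeff (\<Phi> (F_word (drop 1 p))) (?ones n) = lam \<Phi> ^ n" using Suc by simp
    finally show ?case by simp
  qed
  \<comment> \<open>Every position is a partial sum of (1^n), so descents are unrestricted.\<close>
  moreover have "block_shuffles p (?ones (length p)) = rearrangements p"
    unfolding block_shuffles_def partial_sums_replicate_1 using descents_map_subset by fastforce
  moreover have "?ones (length p) \<in> Comp (length p)"
    by (auto simp: Comp_def compositions_def sum_list_replicate)
  ultimately show ?thesis using M_coeff_image_F_word[OF assms] by metis
qed

end

section \<open>Markov chains and generation by a descent class\<close>

text \<open>This is irreducibility phrased without paths: the states from which a given state can be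
  reached form a set closed under predecessors.\<close>

definition pred_connected :: "'a set \<Rightarrow> ('a \<Rightarrow> 'a \<Rightarrow> real) \<Rightarrow> bool" where
  "pred_connected X P \<longleftrightarrow>
     (\<forall>Z. Z \<subseteq> X \<longrightarrow> Z \<noteq> {} \<longrightarrow> (\<forall>x\<in>X. \<forall>y\<in>Z. 0 < P x y \<longrightarrow> x \<in> Z) \<longrightarrow> Z = X)"

text \<open>The states at which \<open>\<nu> / \<mu>\<close> is minimal are closed under predecessors.\<close>

lemma unique_stationary_distributionI:
  assumes fin: "finite X" and \<mu>: "stationary_distribution X P \<mu>"
    and pos: "\<And>x. x \<in> X \<Longrightarrow> 0 < \<mu> x" and conn: "pred_connected X P"
  shows "unique_stationary_distribution X P \<mu>"
  unfolding unique_stationary_distribution_def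
proof (intro conjI allI impI)
  fix \<nu> assume \<nu>: "stationary_distribution X P \<nu>"
  have P: "\<And>x y. x \<in> X \<Longrightarrow> y \<in> X \<Longrightarrow> 0 \<le> P x y"
    and \<mu>P: "\<And>y. y \<in> X \<Longrightarrow> (\<Sum>x\<in>X. \<mu> x * P x y) = \<mu> y" and \<mu>1: "(\<Sum>x\<in>X. \<mu> x) = 1"
    using \<mu> by (auto simp: stationary_distribution_def stochastic_matrix_def probability_vector_def)
  have \<nu>P: "\<And>y. y \<in> X \<Longrightarrow> (\<Sum>x\<in>X. \<nu> x * P x y) = \<nu> y" and \<nu>1: "(\<Sum>x\<in>X. \<nu> x) = 1"
    using \<nu> by (auto simp: stationary_distribution_def probability_vector_def)
  have ne: "X \<noteq> {}" using \<mu>1 by auto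
  define t where "t = Min ((\<lambda>x. \<nu> x / \<mu> x) ` X)"
  have "t \<in> (\<lambda>x. \<nu> x / \<mu> x) ` X" unfolding t_def using fin ne by (intro Min_in) auto
  then obtain x0 where x0: "x0 \<in> X" "t = \<nu> x0 / \<mu> x0" by auto
  \<comment> \<open>Here \<open>t * \<mu>\<close> is the largest multiple of \<open>\<mu>\<close>
    below \<open>\<nu>\<close> on \<open>X\<close>; the difference is nonnegative and invariant, and
    it vanishes at \<open>x0\<close>.\<close>
  define \<rho> where "\<rho> x = \<nu> x - t * \<mu> x" for x
  have \<rho>: "0 \<le> \<rho> x" if "x \<in> X" for x
  proof -
    have "t \<le> \<nu> x / \<mu> x" unfolding t_def using fin that by (intro Min_le) auto
    then show ?thesis using pos[OF that] by (simp add: \<rho>_def pos_le_divide_eq)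
  qed
  have \<rho>P: "(\<Sum>x\<in>X. \<rho> x * P x y) = \<rho> y" if "y \<in> X" for y
    using \<nu>P[OF that] \<mu>P[OF that]
    by (simp add: \<rho>_def left_diff_distrib sum_subtractf mult.assoc sum_distrib_left[symmetric])
  define Z where "Z = {x \<in> X. \<rho> x = 0}"
  have "x \<in> Z" if "x \<in> X" "y \<in> Z" "0 < P x y" for x y
  proof -
    have y: "y \<in> X" "\<rho> y = 0" using that by (auto simp: Z_def)
    then have "\<forall>x\<in>X. \<rho> x * P x y = 0"
      using \<rho>P[OF y(1)] \<rho> P fin by (subst sum_nonneg_eq_0_iff[symmetric]) auto
    then show ?thesis using that by (auto simp: Z_def)
  qed
  moreover have "x0 \<in> Z" using x0 pos[OF x0(1)] by (simp add: Z_def \<rho>_def)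
  moreover have "Z \<subseteq> X" by (auto simp: Z_def)
  ultimately have "Z = X" using conn unfolding pred_connected_def by blast
  then have eq: "\<nu> x = t * \<mu> x" if "x \<in> X" for x using that by (auto simp: Z_def \<rho>_def)
  have "t = 1" using \<nu>1 \<mu>1 by (simp add: eq sum_distrib_left[symmetric])
  then show "\<forall>x\<in>X. \<nu> x = \<mu> x" using eq by simp
qed (use \<mu> in simp)

text \<open>The assumption \<open>lump\<close> is strong lumpability. Stationarity passes to sums
  over fibres, and irreducibility passes on because the preimage of a predecessor-closed set is
  predecessor-closed.\<close>

lemma unique_stationary_distribution_lumped:
  assumes fin: "finite X" and f: "f ` X = Y" and \<mu>: "stationary_distribution X P \<mu>"
    and pos: "\<And>x. x \<in> X \<Longrightarrow> 0 < \<mu> x" and conn: "pred_connected X P"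
    and lump: "\<And>x y. x \<in> X \<Longrightarrow> y \<in> Y \<Longrightarrow> Q (f x) y = (\<Sum>z | z \<in> X \<and> f z = y. P x z)"
  shows "unique_stationary_distribution Y Q (\<lambda>y. \<Sum>x | x \<in> X \<and> f x = y. \<mu> x)"
proof (rule unique_stationary_distributionI)
  have P: "\<And>x y. x \<in> X \<Longrightarrow> y \<in> X \<Longrightarrow> 0 \<le> P x y" "\<And>x. x \<in> X \<Longrightarrow> (\<Sum>y\<in>X. P x y) = 1"
    and \<mu>P: "\<And>y. y \<in> X \<Longrightarrow> (\<Sum>x\<in>X. \<mu> x * P x y) = \<mu> y" and \<mu>1: "(\<Sum>x\<in>X. \<mu> x) = 1"
    using \<mu> by (auto simp: stationary_distribution_def stochastic_matrix_def probability_vector_def)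
  show finY: "finite Y" using fin f by auto
  have group: "(\<Sum>y\<in>Y. \<Sum>x | x \<in> X \<and> f x = y. h x) = (\<Sum>x\<in>X. h x)" for h :: "'a \<Rightarrow> real"
    using sum.group[OF fin finY] f by blast
  have "stochastic_matrix Y Q"
    unfolding stochastic_matrix_def
  proof (intro conjI ballI)
    fix y y' assume y: "y \<in> Y" "y' \<in> Y"
    then obtain x where "x \<in> X" "y = f x" using f by auto
    then show "0 \<le> Q y y'" using lump y P by (auto intro!: sum_nonneg)
  next
    fix y assume "y \<in> Y"
    then obtain x where "x \<in> X" "y = f x" using f by auto
    then show "(\<Sum>y'\<in>Y. Q y y') = 1" using lump P group[of "P x"] by simp
  qed
  moreover have "probability_vector Y (\<lambda>y. \<Sum>x | x \<in> X \<and> f x = y. \<mu> x)"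
    unfolding probability_vector_def group
  proof (intro conjI ballI sum_nonneg)
    fix x y assume "x \<in> {x \<in> X. f x = y}"
    then show "0 \<le> \<mu> x" using pos[of x] by simp
  qed (rule \<mu>1)
  moreover have "(\<Sum>y\<in>Y. (\<Sum>x | x \<in> X \<and> f x = y. \<mu> x) * Q y y') = (\<Sum>x | x \<in> X \<and> f x = y'. \<mu> x)"
    if y': "y' \<in> Y" for y'
  proof -
    have "(\<Sum>y\<in>Y. (\<Sum>x | x \<in> X \<and> f x = y. \<mu> x) * Q y y') =
        (\<Sum>y\<in>Y. \<Sum>x | x \<in> X \<and> f x = y. \<mu> x * (\<Sum>z | z \<in> X \<and> f z = y'. P x z))"
      unfolding sum_distrib_right by (intro sum.cong refl) (use lump y' in auto)
    also have "\<dots> = (\<Sum>x\<in>X. \<Sum>z | z \<in> X \<and> f z = y'. \<mu> x * P x z)"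
      unfolding group by (simp add: sum_distrib_left)
    also have "\<dots> = (\<Sum>z | z \<in> X \<and> f z = y'. \<Sum>x\<in>X. \<mu> x * P x z)" by (rule sum.swap)
    also have "\<dots> = (\<Sum>z | z \<in> X \<and> f z = y'. \<mu> z)" using \<mu>P by (intro sum.cong) auto
    finally show ?thesis .
  qed
  ultimately show "stationary_distribution Y Q (\<lambda>y. \<Sum>x | x \<in> X \<and> f x = y. \<mu> x)"
    by (simp add: stationary_distribution_def)
  show "0 < (\<Sum>x | x \<in> X \<and> f x = y. \<mu> x)" if "y \<in> Y" for y
    using that f fin pos by (intro sum_pos) auto
  show "pred_connected Y Q"
    unfolding pred_connected_def
  proof (intro allI impI)
    fix Z assume Z: "Z \<subseteq> Y" "Z \<noteq> {}" "\<forall>x\<in>Y. \<forall>y\<in>Z. 0 < Q x y \<longrightarrow> x \<in> Z"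
    let ?W = "{x \<in> X. f x \<in> Z}"
    have "x \<in> ?W" if "x \<in> X" "y \<in> ?W" "0 < P x y" for x y
    proof -
      have "P x y \<le> (\<Sum>z | z \<in> X \<and> f z = f y. P x z)"
        using that P fin by (intro member_le_sum) auto
      then have "0 < Q (f x) (f y)" using lump[of x "f y"] that f by auto
      then show ?thesis using Z(3) that f by auto
    qed
    moreover have "?W \<noteq> {}" using Z f by auto
    ultimately have "?W = X" using conn unfolding pred_connected_def by blast
    then show "Z = Y" using Z(1) f by auto
  qed
qed

section \<open>Words and permutations with prescribed descents\<close>

lemma exists_word_with_descents:
  assumes "finite (A :: nat set)"
  shows "\<exists>w. distinct w \<and> set w = A \<and> (\<forall>j. Suc j < length w \<longrightarrow> (w ! j > w ! Suc j \<longleftrightarrow> P j))"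
  using assms
proof (induction "card A" arbitrary: A)
  case 0
  then show ?case by (intro exI[of _ "[]"]) auto
next
  case (Suc m)
  \<comment> \<open>An extremal letter is put last: the least forces a descent and the greatest an
    ascent at the last comparison, whose index is \<open>m - 1\<close>. For \<open>m = 0\<close> the
    alphabet is a single letter and both choices coincide.\<close>
  define x where "x = (if P (m - 1) then Min A else Max A)"
  have ne: "A \<noteq> {}" using Suc.hyps(2) by auto
  then have x: "x \<in> A" using Suc.prems by (simp add: x_def)
  obtain w where w: "distinct w" "set w = A - {x}"
    "\<And>j. Suc j < length w \<Longrightarrow> w ! j > w ! Suc j \<longleftrightarrow> P j"
    using Suc.hyps(1)[of "A - {x}"] Suc.hyps(2)[symmetric] Suc.prems x by fastforce
  then have len: "length w = m" using distinct_card[of w] Suc.hyps(2) x Suc.prems by simp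
  have "(w @ [x]) ! j > (w @ [x]) ! Suc j \<longleftrightarrow> P j" if j: "Suc j < length (w @ [x])" for j
  proof (cases "Suc j < m")
    case True
    then show ?thesis using w(3)[of j] len by (simp add: nth_append)
  next
    case False
    then have jm: "m = Suc j" using j len by simp
    then have "w ! j \<in> A - {x}" using w(2) len by (metis lessI nth_mem)
    then have "w ! j \<in> A" "w ! j \<noteq> x" "x \<noteq> w ! j" by auto
    moreover from this have "Min A \<le> w ! j" "w ! j \<le> Max A" using Suc.prems by simp_all
    moreover have "x = (if P j then Min A else Max A)" using jm by (simp add: x_def)
    ultimately have "w ! j > x \<longleftrightarrow> P j" by (metis le_neq_trans not_less)
    then show ?thesis using jm len by (simp add: nth_append)
  qed
  then show ?case using w x by (intro exI[of _ "w @ [x]"]) auto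
qed

definition one_line :: "nat \<Rightarrow> (nat \<Rightarrow> nat) \<Rightarrow> nat list"
  where "one_line n \<sigma> = map \<sigma> [1..<Suc n]"

lemma length_one_line [simp]: "length (one_line n \<sigma>) = n" by (simp add: one_line_def)

lemma nth_one_line [simp]: "i < n \<Longrightarrow> one_line n \<sigma> ! i = \<sigma> (Suc i)" by (simp add: one_line_def del: upt_Suc)

lemma D_eq: "D n \<sigma> = co n (descents (one_line n \<sigma>))"
proof -
  have "{i \<in> {1..<n}. \<sigma> i > \<sigma> (i + 1)} = descents (one_line n \<sigma>)" by (auto simp: descents_def)
  then show ?thesis by (simp add: D_def)
qed

lemma D_in_Comp [simp]: "D n \<sigma> \<in> Comp n"
  using co_descents_in_Comp[of "one_line n \<sigma>"] by (simp add: D_eq del: co_descents_in_Comp)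

lemma D_eq_iff: "\<alpha> \<in> Comp n \<Longrightarrow> D n \<sigma> = \<alpha> \<longleftrightarrow> {i \<in> {1..<n}. \<sigma> i > \<sigma> (i + 1)} = S_of \<alpha>"
  unfolding D_def by (metis (no_types, lifting) S_of_co co_S_of mem_Collect_eq subsetI)

lemma finite_Sym [simp]: "finite (Sym n)"
  unfolding Sym_def by (rule finite_permutations) simp

lemma word_to_perm:
  assumes "distinct w" "set w = {1..n}"
  obtains \<sigma> where "\<sigma> \<in> Sym n" "one_line n \<sigma> = w"
proof -
  have len: "length w = n" using distinct_card[OF assms(1)] assms(2) by simp
  define \<sigma> where "\<sigma> i = (if i \<in> {1..n} then w ! (i - 1) else i)" for i
  have "\<sigma> ` {1..n} = {1..n}"
  proof (intro equalityI subsetI)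
    fix x assume "x \<in> \<sigma> ` {1..n}"
    then obtain i where "1 \<le> i" "i \<le> n" "x = w ! (i - 1)" by (auto simp: \<sigma>_def)
    then have "x \<in> set w" using len by auto
    then show "x \<in> {1..n}" using assms by simp
  next
    fix x assume "x \<in> {1..n}"
    then obtain i where "i < n" "x = w ! i" using assms len by (metis in_set_conv_nth)
    then show "x \<in> \<sigma> ` {1..n}" by (auto simp: \<sigma>_def intro!: image_eqI[of _ _ "Suc i"])
  qed
  then have "bij_betw \<sigma> {1..n} {1..n}" by (simp add: bij_betw_def eq_card_imp_inj_on)
  then have "\<sigma> permutes {1..n}" by (rule bij_imp_permutes) (auto simp: \<sigma>_def)
  moreover have "one_line n \<sigma> = w" by (rule nth_equalityI) (auto simp: len \<sigma>_def)
  ultimately show ?thesis using that by (simp add: Sym_def)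
qed

lemma distinct_one_line: "\<sigma> \<in> Sym n \<Longrightarrow> distinct (one_line n \<sigma>)"
  by (auto simp: one_line_def Sym_def distinct_map permutes_inj_on simp del: upt_Suc)

lemma set_one_line: "\<sigma> \<in> Sym n \<Longrightarrow> set (one_line n \<sigma>) = {1..n}"
  using permutes_image[of \<sigma> "{1..n}"] by (simp add: one_line_def Sym_def atLeastLessThanSuc_atLeastAtMost del: upt_Suc)

lemma exists_perm_with_descents:
  assumes "S \<subseteq> {1..<n}"
  obtains \<sigma> where "\<sigma> \<in> Sym n" "{i \<in> {1..<n}. \<sigma> i > \<sigma> (i + 1)} = S"
proof -
  obtain w where w: "distinct w" "set w = {1..n}"
    "\<And>j. Suc j < length w \<Longrightarrow> w ! j > w ! Suc j \<longleftrightarrow> Suc j \<in> S"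
    using exists_word_with_descents[of "{1..n}" "\<lambda>j. Suc j \<in> S"] by auto
  obtain \<sigma> where \<sigma>: "\<sigma> \<in> Sym n" "one_line n \<sigma> = w" using w by (metis word_to_perm)
  have "\<sigma> i > \<sigma> (i + 1) \<longleftrightarrow> i \<in> S" if "i \<in> {1..<n}" for i
    using w(3)[of "i - 1"] that by (simp add: \<sigma>(2)[symmetric])
  then have "{i \<in> {1..<n}. \<sigma> i > \<sigma> (i + 1)} = S" using assms by auto
  then show ?thesis using \<sigma>(1) that by blast
qed

lemma D_surj: "D n ` Sym n = Comp n"
proof (intro equalityI subsetI)
  fix \<alpha> assume \<alpha>: "\<alpha> \<in> Comp n"
  obtain \<sigma> where "\<sigma> \<in> Sym n" "{i \<in> {1..<n}. \<sigma> i > \<sigma> (i + 1)} = S_of \<alpha>"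
    using exists_perm_with_descents[OF S_of_subset[OF \<alpha>]] by blast
  then show "\<alpha> \<in> D n ` Sym n" using D_eq_iff[OF \<alpha>, of \<sigma>] by (intro image_eqI[of _ _ \<sigma>]) simp_all
qed auto

text \<open>By \<open>ends\<close>, the comparisons of \<open>e\<close> with its neighbours come out
  as \<open>S\<close> demands, whatever these neighbours are. So the other letters may be divided
  freely between the two sides, and each side is arranged by
  \<open>exists_word_with_descents\<close>.\<close>

lemma exists_perm_with_extremal_letter:
  assumes p: "1 < p" "p < n" and S: "S \<subseteq> {1..<n}" and e: "e \<in> {1..n}"
    and ends: "\<And>x. x \<in> {1..n} - {e} \<Longrightarrow> (x > e \<longleftrightarrow> p - 1 \<in> S) \<and> (e > x \<longleftrightarrow> p \<in> S)"
    and kl: "k \<in> {1..n} - {e}" "l \<in> {1..n} - {e}" "k \<noteq> l"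
  obtains \<sigma> a b where "\<sigma> \<in> Sym n" "{i \<in> {1..<n}. \<sigma> i > \<sigma> (i + 1)} = S" "\<sigma> p = e"
    "a \<in> {1..<p}" "b \<in> {p<..n}" "\<sigma> a = k" "\<sigma> b = l"
proof -
  let ?V = "{1..n} - {e}"
  \<comment> \<open>The left side has \<open>p - 1\<close> places, one of which is reserved for
    \<open>k\<close>.\<close>
  have "p - 2 \<le> card (?V - {k, l})" using kl e p by (simp add: card_Diff_subset)
  then obtain A' where A': "A' \<subseteq> ?V - {k, l}" "card A' = p - 2" by (rule obtain_subset_with_card_n)
  define A where "A = insert k A'"
  define B where "B = ?V - A"
  have fin: "finite A'" using A'(1) by (rule finite_subset) simp
  have cA: "card A = p - 1" using A' p kl fin by (auto simp: A_def card_insert_if)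
  have AV: "A \<subseteq> ?V" using A' kl by (auto simp: A_def)
  have cB: "card B = n - p" 
    unfolding B_def using AV cA e p fin by (subst card_Diff_subset) (auto simp: A_def)
  have kA: "k \<in> A" "l \<in> B" using A' kl by (auto simp: A_def B_def)
  obtain u where u: "distinct u" "set u = A"
    "\<And>j. Suc j < length u \<Longrightarrow> u ! j > u ! Suc j \<longleftrightarrow> Suc j \<in> S"
    using exists_word_with_descents[of A "\<lambda>j. Suc j \<in> S"] fin by (auto simp: A_def)
  obtain v where v: "distinct v" "set v = B"
    "\<And>j. Suc j < length v \<Longrightarrow> v ! j > v ! Suc j \<longleftrightarrow> p + Suc j \<in> S"
    using exists_word_with_descents[of B "\<lambda>j. p + Suc j \<in> S"] by (auto simp: B_def)
  have lu: "length u = p - 1" using u cA distinct_card by metis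
  have lv: "length v = n - p" using v cB distinct_card by metis
  let ?w = "u @ e # v"
  have "distinct ?w" "set ?w = {1..n}" using u v AV e by (auto simp: B_def)
  then obtain \<sigma> where \<sigma>: "\<sigma> \<in> Sym n" "one_line n \<sigma> = ?w" by (metis word_to_perm)
  have val: "\<sigma> i = ?w ! (i - 1)" if "i \<in> {1..n}" for i
    using that unfolding \<sigma>(2)[symmetric] by (auto simp: Suc_diff_le)
  have \<sigma>u: "\<sigma> i = u ! (i - 1)" if "i \<in> {1..<p}" for i
    using that p lu val[of i] by (auto simp: nth_append)
  have \<sigma>e: "\<sigma> p = e" using p lu val[of p] by (auto simp: nth_append)
  have \<sigma>v: "\<sigma> i = v ! (i - p - 1)" if "i \<in> {p<..n}" for i
  proof -
    have "i - 1 - (p - 1) = Suc (i - p - 1)" "\<not> i - 1 < p - 1" using that p by auto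
    then show ?thesis using that p lu val[of i] by (simp add: nth_append)
  qed
  have uV: "u ! j \<in> ?V" if "j < p - 1" for j using that lu u(2) AV nth_mem[of j u] by auto
  have vV: "v ! j \<in> ?V" if "j < n - p" for j using that lv v(2) nth_mem[of j v] by (auto simp: B_def)
  have "\<sigma> i > \<sigma> (i + 1) \<longleftrightarrow> i \<in> S" if i: "i \<in> {1..<n}" for i
  proof -
    consider "i + 1 < p" | "i = p - 1" | "i = p" | "p < i" using p by linarith
    then show ?thesis
    proof cases
      case 1
      then show ?thesis using \<sigma>u[of i] \<sigma>u[of "i + 1"] u(3)[of "i - 1"] lu i by simp
    next
      case 2
      then show ?thesis using \<sigma>u[of i] \<sigma>e p ends[OF uV[of "i - 1"]] i by simp
    next
      case 3
      then show ?thesis using \<sigma>v[of "i + 1"] \<sigma>e p ends[OF vV[of 0]] i by simp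
    next
      case 4
      then have "Suc (i - p - 1) = i - p" "p + (i - p) = i" by auto
      then show ?thesis using \<sigma>v[of i] \<sigma>v[of "i + 1"] v(3)[of "i - p - 1"] lv i 4 by simp
    qed
  qed
  then have D: "{i \<in> {1..<n}. \<sigma> i > \<sigma> (i + 1)} = S" using S by auto
  obtain i where i: "i < p - 1" "u ! i = k" using kA(1) u(2) lu by (metis in_set_conv_nth)
  obtain j where j: "j < n - p" "v ! j = l" using kA(2) v(2) lv by (metis in_set_conv_nth)
  have "\<sigma> (i + 1) = k" using \<sigma>u[of "i + 1"] i by simp
  moreover have "\<sigma> (p + j + 1) = l" using \<sigma>v[of "p + j + 1"] j by simp
  ultimately show ?thesis using that[OF \<sigma>(1) D \<sigma>e, of "i + 1" "p + j + 1"] i j by simp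
qed

section \<open>Generation of the symmetric group by a descent class\<close>

lemma transpose_Suc_less_iff:
  fixes x y k :: nat
  assumes "x \<noteq> y" "\<not> (x = k \<and> y = Suc k)" "\<not> (x = Suc k \<and> y = k)"
  shows "transpose k (Suc k) x < transpose k (Suc k) y \<longleftrightarrow> x < y"
  using assms by (auto simp: transpose_def)

text \<open>If membership in \<open>S\<close> never changed between neighbours, \<open>S\<close>
  would be empty or everything.\<close>

lemma exists_peak_or_valley:
  fixes n :: nat
  assumes "S \<subseteq> {1..<n}" "S \<noteq> {}" "S \<noteq> {1..<n}"
  obtains p where "1 < p" "p < n" "p - 1 \<in> S \<longleftrightarrow> p \<notin> S"
proof (rule ccontr)
  assume "\<not> thesis"
  with that have const: "p - 1 \<in> S \<longleftrightarrow> p \<in> S" if "1 < p" "p < n" for p using that by blast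
  have "i \<in> S \<longleftrightarrow> 1 \<in> S" if "1 \<le> i" "i < n" for i :: nat
    using that
  proof (induction i rule: dec_induct)
    case (step i)
    then show ?case using const[of "Suc i"] by simp
  qed simp
  then show False using assms by (cases "1 \<in> S") fastforce+
qed

text \<open>Generation is expressed through a set closed under left multiplication, the form that
  \<open>pred_connected\<close> calls for. The permutations preserving this set form a group
  \<open>G\<close>, which is shown to be the full symmetric group.\<close>

lemma descent_class_generates:
  assumes \<alpha>: "\<alpha> \<in> Comp n - {one_part n, all_ones n}"
    and Z: "Z \<subseteq> Sym n" "Z \<noteq> {}"
    and closed: "\<And>\<sigma> \<tau>. \<sigma> \<in> Sym n \<Longrightarrow> D n \<sigma> = \<alpha> \<Longrightarrow> \<tau> \<in> Z \<Longrightarrow> \<sigma> \<circ> \<tau> \<in> Z"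
  shows "Z = Sym n"
proof -
  let ?S = "S_of \<alpha>"
  have \<alpha>C: "\<alpha> \<in> Comp n" using \<alpha> by simp
  have S: "?S \<subseteq> {1..<n}" using S_of_subset \<alpha>C by blast
  have ones: "all_ones n \<in> compositions" "sum_list (all_ones n) = n"
    by (auto simp: all_ones_def compositions_def sum_list_replicate)
  have "S_of (all_ones n) = {0..n} - {0, n}"
    unfolding S_of_eq_partial_sums[OF ones(1)] ones(2) by (simp only: all_ones_def partial_sums_replicate_1)
  also have "{0..n} - {0, n} = {1..<n}" by auto
  finally have "S_of (all_ones n) = {1..<n}" .
  moreover have "all_ones n \<in> Comp n" using ones by (simp add: Comp_def)
  ultimately have "?S \<noteq> {}" "?S \<noteq> {1..<n}"
    using \<alpha> inj_onD[OF inj_on_S_of, of \<alpha> "one_part n" n] inj_onD[OF inj_on_S_of, of \<alpha> "all_ones n" n]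
      one_part_in_Comp[of n] S_of_one_part[of n] by blast+
  then obtain p where p: "1 < p" "p < n" "p - 1 \<in> ?S \<longleftrightarrow> p \<notin> ?S"
    using exists_peak_or_valley[OF S] by blast
  \<comment> \<open>A peak at \<open>p\<close> receives the greatest letter, a valley the least. As
    \<open>1 < p < n\<close>, a permutation carrying \<open>p\<close> to \<open>e\<close> must move
    \<open>e\<close>.\<close>
  define e where "e = (if p \<in> ?S then n else 1)"
  let ?V = "{1..n} - {e}"
  have e: "e \<in> {1..n}" "p \<noteq> e" using p by (auto simp: e_def)
  have ends: "(x > e \<longleftrightarrow> p - 1 \<in> ?S) \<and> (e > x \<longleftrightarrow> p \<in> ?S)" if "x \<in> ?V" for x
    using that p by (auto simp: e_def split: if_splits)
  define G where "G = {g. g permutes {1..n} \<and> (\<forall>\<tau>\<in>Z. g \<circ> \<tau> \<in> Z)}"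
  have G_comp: "g \<circ> h \<in> G" if "g \<in> G" "h \<in> G" for g h
    using that by (auto simp: G_def comp_assoc intro: permutes_compose)
  have finZ: "finite Z" using Z(1) by (rule finite_subset) simp
  have G_inv: "inv g \<in> G" if "g \<in> G" for g
  proof -
    have g: "g permutes {1..n}" "\<forall>\<tau>\<in>Z. g \<circ> \<tau> \<in> Z" using that by (auto simp: G_def)
    \<comment> \<open>Left multiplication by \<open>g\<close> is an injection of the finite set
      \<open>Z\<close> into itself, hence onto, so the inverse preserves \<open>Z\<close>
      too.\<close>
    have "inj_on ((\<circ>) g) Z"
      by (rule inj_onI) (metis g(1) comp_assoc id_comp permutes_inv_o(2))
    then have "(\<circ>) g ` Z = Z" using finZ g(2) by (intro endo_inj_surj) auto
    then have "inv g \<circ> \<tau> \<in> Z" if "\<tau> \<in> Z" for \<tau>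
      using that by (metis (no_types, lifting) g(1) comp_assoc id_comp imageE permutes_inv_o(2))
    then show ?thesis using permutes_inv[OF g(1)] by (simp add: G_def)
  qed
  have D_G: "\<sigma> \<in> G" if "\<sigma> \<in> Sym n" "{i \<in> {1..<n}. \<sigma> i > \<sigma> (i + 1)} = ?S" for \<sigma>
    using that closed D_eq_iff[OF \<alpha>C] by (auto simp: G_def Sym_def)
  have adj: "transpose k (Suc k) \<in> G" if k: "k \<in> ?V" "Suc k \<in> ?V" for k
  proof -
    obtain \<sigma> a b where \<sigma>: "\<sigma> \<in> Sym n" "{i \<in> {1..<n}. \<sigma> i > \<sigma> (i + 1)} = ?S" "\<sigma> p = e"
      "a \<in> {1..<p}" "b \<in> {p<..n}" "\<sigma> a = k" "\<sigma> b = Suc k"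
      using ends by (rule exists_perm_with_extremal_letter[OF p(1,2) S e(1) _ k n_not_Suc_n])
    let ?t = "transpose k (Suc k)"
    have perm: "\<sigma> permutes {1..n}" using \<sigma>(1) by (simp add: Sym_def)
    then have inj: "inj \<sigma>" by (rule permutes_inj)
    have "?t \<circ> \<sigma> \<in> Sym n"
      using perm k by (auto simp: Sym_def intro!: permutes_compose permutes_swap_id)
    \<comment> \<open>The letters \<open>k\<close> and \<open>Suc k\<close> stand on different sides
      of position \<open>p\<close>, so they are never neighbours, and exchanging two consecutive
      values alters no other comparison.\<close>
    moreover have "?t (\<sigma> i) > ?t (\<sigma> (i + 1)) \<longleftrightarrow> \<sigma> i > \<sigma> (i + 1)" for i
    proof (rule transpose_Suc_less_iff)
      show "\<sigma> (i + 1) \<noteq> \<sigma> i" using inj by (auto simp: inj_eq)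
      have "j = a" if "\<sigma> j = k" for j using that \<sigma>(6) inj by (metis injD)
      moreover have "j = b" if "\<sigma> j = Suc k" for j using that \<sigma>(7) inj by (metis injD)
      ultimately show "\<not> (\<sigma> (i + 1) = k \<and> \<sigma> i = Suc k)" "\<not> (\<sigma> (i + 1) = Suc k \<and> \<sigma> i = k)"
        using \<sigma>(4,5) by fastforce+
    qed
    ultimately have "?t \<circ> \<sigma> \<in> G" using \<sigma>(2) by (intro D_G) auto
    then have "(?t \<circ> \<sigma>) \<circ> inv \<sigma> \<in> G" by (rule G_comp[OF _ G_inv[OF D_G[OF \<sigma>(1,2)]]])
    then show ?thesis by (simp add: comp_assoc permutes_inv_o(1)[OF perm])
  qed
  have tr_less: "transpose a (a + Suc d) \<in> G" if "a \<in> ?V" "a + Suc d \<in> ?V" for a d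
    using that
  proof (induction d)
    case 0
    then show ?case using adj by simp
  next
    case (Suc d)
    let ?b = "a + Suc d"
    \<comment> \<open>Since \<open>e\<close> is an end of the interval, letters between two elements
      of \<open>?V\<close> stay in \<open>?V\<close>.\<close>
    have b: "?b \<in> ?V" "Suc ?b \<in> ?V" using Suc.prems p by (auto simp: e_def split: if_splits)
    have "transpose a (Suc ?b) = transpose ?b (Suc ?b) \<circ> (transpose a ?b \<circ> transpose ?b (Suc ?b))"
      by (auto simp: transpose_def fun_eq_iff)
    moreover have "\<dots> \<in> G"
      by (rule G_comp[OF adj[OF b] G_comp[OF Suc.IH[OF Suc.prems(1) b(1)] adj[OF b]]])
    ultimately show ?case by (simp only: add_Suc_right)
  qed
  have tr: "transpose a b \<in> G" if ab: "a \<in> ?V" "b \<in> ?V" "a \<noteq> b" for a b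
  proof -
    consider d where "b = a + Suc d" | d where "a = b + Suc d"
      using ab(3) by (metis add_Suc_right less_iff_Suc_add linorder_neqE_nat)
    then show ?thesis
    proof cases
      case 1 then show ?thesis using tr_less ab by blast
    next
      case 2 then show ?thesis using tr_less[of b] ab by (metis transpose_commute)
    qed
  qed
  have fix_G: "g \<in> G" if "g permutes {1..n}" "g e = e" for g
  proof -
    have "g permutes ?V" using that by (intro permutes_superset[OF that(1)]) auto
    moreover have "finite ?V" by simp
    ultimately show ?thesis
    proof (induction rule: permutes_induct)
      case id
      have "id \<circ> \<tau> = \<tau>" for \<tau> :: "nat \<Rightarrow> nat" by (rule id_comp)
      then show ?case unfolding G_def using permutes_id by (simp del: id_apply)
    next
      case (swap a b q)
      then show ?case by (intro G_comp tr)
    qed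
  qed
  \<comment> \<open>Because \<open>n\<close> is at least 3, two consecutive letters other than
    \<open>e\<close> exist; they serve to obtain a member of the class carrying \<open>p\<close> to
    \<open>e\<close>.\<close>
  obtain k where k: "k \<in> ?V" "Suc k \<in> ?V"
  proof (cases "e = n")
    case True then show ?thesis using p that[of 1] by auto
  next
    case False then show ?thesis using p that[of 2] by (auto simp: e_def split: if_splits)
  qed
  obtain \<sigma> a b where \<sigma>: "\<sigma> \<in> Sym n" "{i \<in> {1..<n}. \<sigma> i > \<sigma> (i + 1)} = ?S" "\<sigma> p = e"
      "a \<in> {1..<p}" "b \<in> {p<..n}" "\<sigma> a = k" "\<sigma> b = Suc k"
    using ends by (rule exists_perm_with_extremal_letter[OF p(1,2) S e(1) _ k n_not_Suc_n])
  have \<sigma>perm: "\<sigma> permutes {1..n}" using \<sigma>(1) by (simp add: Sym_def)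
  have all_G: "h \<in> G" if h: "h permutes {1..n}" for h
  proof (cases "h e = e")
    case True
    then show ?thesis using h fix_G by blast
  next
    case False
    \<comment> \<open>\<open>?r\<close> fixes \<open>e\<close> and carries \<open>\<sigma> e\<close>
      to \<open>h e\<close>. Thus \<open>?r \<circ> \<sigma>\<close> agrees with \<open>h\<close> at
      \<open>e\<close>, and the two differ by a permutation fixing \<open>e\<close>.\<close>
    let ?r = "transpose (h e) (\<sigma> e)"
    have "\<sigma> e \<noteq> e" using \<sigma>(3) e(2) permutes_inj[OF \<sigma>perm] by (metis injD)
    then have V: "h e \<in> ?V" "\<sigma> e \<in> ?V"
      using False e(1) permutes_in_image[OF h, of e] permutes_in_image[OF \<sigma>perm, of e] by auto
    have r: "?r permutes {1..n}" using V by (intro permutes_swap_id) auto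
    have "?r e = e" using V by (auto simp: transpose_def)
    then have "?r \<in> G" using r by (intro fix_G)
    then have rG: "?r \<circ> \<sigma> \<in> G" using D_G[OF \<sigma>(1,2)] by (rule G_comp)
    have rp: "?r \<circ> \<sigma> permutes {1..n}" using r \<sigma>perm by (intro permutes_compose)
    have "(?r \<circ> \<sigma>) e = h e" by simp
    then have "inv (?r \<circ> \<sigma>) (h e) = e" using permutes_inv_eq[OF rp] by blast
    then have "inv (?r \<circ> \<sigma>) \<circ> h \<in> G"
      using permutes_compose[OF h permutes_inv[OF rp]] by (intro fix_G) auto
    then have "(?r \<circ> \<sigma>) \<circ> (inv (?r \<circ> \<sigma>) \<circ> h) \<in> G" by (rule G_comp[OF rG])
    then show ?thesis by (simp add: comp_assoc[symmetric] permutes_inv_o(1)[OF rp])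
  qed
  obtain \<tau> where \<tau>: "\<tau> \<in> Z" using Z(2) by blast
  then have \<tau>p: "\<tau> permutes {1..n}" using Z(1) by (auto simp: Sym_def)
  have "g \<in> Z" if "g \<in> Sym n" for g
  proof -
    have "g \<circ> inv \<tau> \<in> G"
      using that \<tau>p by (intro all_G permutes_compose permutes_inv) (auto simp: Sym_def)
    then have "(g \<circ> inv \<tau>) \<circ> \<tau> \<in> Z" using \<tau> by (simp add: G_def)
    then show ?thesis by (simp add: comp_assoc permutes_inv_o(2)[OF \<tau>p])
  qed
  then show ?thesis using Z(1) by blast
qed

section \<open>Lumping along descent compositions\<close>

lemma nth_one_line_diff: "i \<in> {1..n} \<Longrightarrow> one_line n \<sigma> ! (i - 1) = \<sigma> i"
  by (cases i) auto

lemma bij_betw_one_line: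
  assumes "\<pi> \<in> Sym n"
  shows "bij_betw (one_line n) (Sym n) (rearrangements (one_line n \<pi>))"
  unfolding bij_betw_def
proof
  show "inj_on (one_line n) (Sym n)"
  proof (intro inj_onI ext)
    fix \<sigma> \<tau> i assume *: "\<sigma> \<in> Sym n" "\<tau> \<in> Sym n" "one_line n \<sigma> = one_line n \<tau>"
    show "\<sigma> i = \<tau> i"
    proof (cases "i \<in> {1..n}")
      case True
      then show ?thesis using *(3) by (metis nth_one_line_diff)
    next
      case False
      then show ?thesis using * by (auto simp: Sym_def permutes_def)
    qed
  qed
  show "one_line n ` Sym n = rearrangements (one_line n \<pi>)"
  proof (intro equalityI subsetI)
    fix w assume "w \<in> rearrangements (one_line n \<pi>)"
    then have "distinct w" "set w = {1..n}" using set_one_line[OF assms] by (auto simp: rearrangements_def)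
    then show "w \<in> one_line n ` Sym n" by (metis word_to_perm imageI)
  qed (auto simp: rearrangements_def distinct_one_line set_one_line assms)
qed

text \<open>The position of a letter in \<open>one_line n \<sigma>\<close> is its value under
  \<open>inv \<sigma>\<close> minus one, and this shift does not affect comparisons.\<close>

lemma descents_map_position_one_line:
  assumes "\<sigma> \<in> Sym n" "\<pi> \<in> Sym n"
  shows "descents (map (position (one_line n \<sigma>)) (one_line n \<pi>)) = descents (one_line n (inv \<sigma> \<circ> \<pi>))"
proof -
  have \<sigma>: "\<sigma> permutes {1..n}" using assms(1) by (simp add: Sym_def)
  have pos: "Suc (position (one_line n \<sigma>) x) = inv \<sigma> x" if "x \<in> {1..n}" for x
  proof -
    have i: "inv \<sigma> x \<in> {1..n}" using that permutes_in_image[OF permutes_inv[OF \<sigma>]] by blast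
    then have "one_line n \<sigma> ! (inv \<sigma> x - 1) = x" using nth_one_line_diff permutes_inverses(1)[OF \<sigma>] by metis
    then show ?thesis using position_nth[OF distinct_one_line[OF assms(1)], of "inv \<sigma> x - 1"] i
      by (cases "inv \<sigma> x") auto
  qed
  have "descents (map (position (one_line n \<sigma>)) (one_line n \<pi>)) = descents (map (inv \<sigma>) (one_line n \<pi>))"
  proof (rule descents_map_cong)
    fix x y assume "x \<in> set (one_line n \<pi>)" "y \<in> set (one_line n \<pi>)"
    then show "position (one_line n \<sigma>) x < position (one_line n \<sigma>) y \<longleftrightarrow> inv \<sigma> x < inv \<sigma> y"
      using pos[of x] pos[of y] set_one_line[OF assms(2)] by (metis Suc_less_eq)
  qed
  also have "map (inv \<sigma>) (one_line n \<pi>) = one_line n (inv \<sigma> \<circ> \<pi>)" by (simp add: one_line_def)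
  finally show ?thesis .
qed

lemma Sym_compose: "\<sigma> \<in> Sym n \<Longrightarrow> \<tau> \<in> Sym n \<Longrightarrow> \<sigma> \<circ> \<tau> \<in> Sym n"
  and Sym_inv: "\<sigma> \<in> Sym n \<Longrightarrow> inv \<sigma> \<in> Sym n"
  by (auto simp: Sym_def permutes_compose permutes_inv)

lemma Sym_inv_o: "\<sigma> \<in> Sym n \<Longrightarrow> inv \<sigma> \<circ> \<sigma> = id" "\<sigma> \<in> Sym n \<Longrightarrow> \<sigma> \<circ> inv \<sigma> = id"
  by (auto simp: Sym_def permutes_inv_o)

lemma Sym_inv_compose: "\<sigma> \<in> Sym n \<Longrightarrow> \<tau> \<in> Sym n \<Longrightarrow> inv (\<sigma> \<circ> inv \<tau>) = \<tau> \<circ> inv \<sigma>"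
  and Sym_inv_inv_compose: "\<sigma> \<in> Sym n \<Longrightarrow> \<tau> \<in> Sym n \<Longrightarrow> inv (inv \<sigma> \<circ> \<tau>) = inv \<tau> \<circ> \<sigma>"
  by (rule inv_unique_comp; auto simp: fun_eq_iff Sym_def permutes_inverses)+

context qsym_end
begin

lemma F_coeff_D_one_part: "\<sigma> \<in> Sym n \<Longrightarrow> F_coeff \<Phi> (D n \<sigma>) (one_part n) = char_val (one_line n \<sigma>)"
  using F_coeff_one_part[OF distinct_one_line, of \<sigma> n] by (simp add: D_eq)

lemma sum_char_val_one_line: "(\<Sum>\<sigma>\<in>Sym n. char_val (one_line n \<sigma>)) = lam \<Phi> ^ n"
proof -
  have "id \<in> Sym n" by (simp add: Sym_def permutes_id)
  from sum.reindex_bij_betw[OF bij_betw_one_line[OF this], of char_val] sum_char_val[OF distinct_one_line[OF this]]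
  show ?thesis by simp
qed

lemma K_eq:
  assumes "\<pi> \<in> Sym n" "\<tau> \<in> Sym n"
  shows "K n \<Phi> \<pi> \<tau> = of_rat (char_val (one_line n (\<pi> \<circ> inv \<tau>)) / lam \<Phi> ^ n)"
proof -
  have "(\<Sum>\<sigma>\<in>Sym n. F_coeff \<Phi> (D n \<sigma>) (one_part n)) = lam \<Phi> ^ n"
    unfolding sum_char_val_one_line[symmetric] by (intro sum.cong) (auto simp: F_coeff_D_one_part)
  moreover have "\<pi> \<circ> inv \<tau> \<in> Sym n" using assms by (intro Sym_compose Sym_inv)
  ultimately show ?thesis
    using assms by (simp add: K_def Prob_def Sym_inv_compose F_coeff_D_one_part)
qed

lemma bij_betw_compose_inv: "\<pi> \<in> Sym n \<Longrightarrow> bij_betw (\<lambda>\<tau>. \<pi> \<circ> inv \<tau>) (Sym n) (Sym n)"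
  by (rule bij_betw_byWitness[where f' = "\<lambda>\<sigma>. inv \<sigma> \<circ> \<pi>"])
     (auto simp: Sym_compose Sym_inv Sym_inv_compose Sym_inv_inv_compose comp_assoc Sym_inv_o
        comp_assoc[symmetric, of \<pi> "inv \<pi>"])

text \<open>The entry is a sum over \<sigma> with
  \<open>D n (inv \<sigma> \<circ> \<pi>) = \<gamma>\<close>; substituting
  \<open>\<sigma> = \<pi> \<circ> inv \<tau>\<close> turns the condition into
  \<open>D n \<tau> = \<gamma>\<close>. This is the lumping along \<open>D\<close>.\<close>

lemma K_bar_eq:
  assumes "\<pi> \<in> Sym n" "\<gamma> \<in> Comp n"
  shows "K_bar n \<Phi> (D n \<pi>) \<gamma> = (\<Sum>\<tau> | \<tau> \<in> Sym n \<and> D n \<tau> = \<gamma>. K n \<Phi> \<pi> \<tau>)"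
proof -
  let ?p = "one_line n \<pi>"
  have "F_coeff \<Phi> (D n \<pi>) \<gamma> = F_matrix ?p \<gamma>"
    using F_coeff_eq_F_matrix[OF distinct_one_line[OF assms(1)]] assms(2) by (simp add: D_eq)
  also have "\<dots> = (\<Sum>w\<in>rearrangements ?p. if co n (descents (map (position w) ?p)) = \<gamma> then char_val w else 0)"
    unfolding F_matrix_def by (simp add: sum.inter_filter)
  also have "\<dots> = (\<Sum>\<sigma>\<in>Sym n. if D n (inv \<sigma> \<circ> \<pi>) = \<gamma> then char_val (one_line n \<sigma>) else 0)"
    unfolding sum.reindex_bij_betw[OF bij_betw_one_line[OF assms(1)], symmetric]
    using assms(1) by (intro sum.cong) (auto simp: D_eq descents_map_position_one_line)
  also have "\<dots> = (\<Sum>\<tau>\<in>Sym n. if D n \<tau> = \<gamma> then char_val (one_line n (\<pi> \<circ> inv \<tau>)) else 0)"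
  proof -
    have "inv (\<pi> \<circ> inv \<tau>) \<circ> \<pi> = \<tau>" if "\<tau> \<in> Sym n" for \<tau>
      unfolding Sym_inv_compose[OF assms(1) that] comp_assoc Sym_inv_o(1)[OF assms(1)] by simp
    then show ?thesis
      by (subst sum.reindex_bij_betw[OF bij_betw_compose_inv[OF assms(1)], symmetric])
        (auto intro: sum.cong)
  qed
  also have "\<dots> = (\<Sum>\<tau> | \<tau> \<in> Sym n \<and> D n \<tau> = \<gamma>. char_val (one_line n (\<pi> \<circ> inv \<tau>)))"
    by (simp add: sum.inter_filter)
  finally show ?thesis
    using assms(1) by (simp add: K_bar_def K_eq of_rat_divide of_rat_sum sum_divide_distrib)
qed

end

theorem theorem3p10:
  fixes n :: nat and \<Phi> :: "pseries \<Rightarrow> pseries"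
  assumes "\<Phi> \<in> QSym_End"
    and "\<forall>\<alpha> \<in> Comp n. 0 \<le> F_coeff \<Phi> \<alpha> (one_part n)"
    and "\<exists>\<alpha> \<in> Comp n. F_coeff \<Phi> \<alpha> (one_part n) \<noteq> 0"
    and "\<exists>\<alpha> \<in> Comp n - {one_part n, all_ones n}. 0 < F_coeff \<Phi> \<alpha> (one_part n)"
  shows "unique_stationary_distribution (Sym n) (K n \<Phi>) (\<lambda>\<sigma>. 1 / fact n) \<and>
         unique_stationary_distribution (Comp n) (K_bar n \<Phi>)
           (\<lambda>\<alpha>. real (card {\<sigma> \<in> Sym n. D n \<sigma> = \<alpha>}) / fact n)"
proof -
  interpret qsym_end \<Phi> using assms(1) by unfold_locales
  let ?P = "K n \<Phi>"
  have char_val_nonneg: "0 \<le> char_val (one_line n \<sigma>)" if "\<sigma> \<in> Sym n" for \<sigma>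
    using assms(2) F_coeff_D_one_part[OF that] D_in_Comp by metis
  obtain \<alpha> where \<alpha>: "\<alpha> \<in> Comp n - {one_part n, all_ones n}" "0 < F_coeff \<Phi> \<alpha> (one_part n)"
    using assms(4) by blast
  have char_val_pos: "0 < char_val (one_line n \<sigma>)" if "\<sigma> \<in> Sym n" "D n \<sigma> = \<alpha>" for \<sigma>
    using \<alpha>(2) F_coeff_D_one_part[OF that(1)] that(2) by simp
  obtain \<rho> where \<rho>: "\<rho> \<in> Sym n" "D n \<rho> = \<alpha>" using \<alpha>(1) D_surj[of n] by (metis DiffD1 imageE)
  \<comment> \<open>The power of \<open>lam \<Phi>\<close> is the sum of all character values, which
    are nonnegative and positive at \<rho>.\<close>
  then have lam_pos: "0 < lam \<Phi> ^ n"
    unfolding sum_char_val_one_line[symmetric] using char_val_pos char_val_nonneg \<rho> by (intro sum_pos2[of _ \<rho>]) auto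
  have sum1: "(\<Sum>\<sigma>\<in>Sym n. of_rat (char_val (one_line n \<sigma>) / lam \<Phi> ^ n)) = (1::real)"
    unfolding of_rat_sum[symmetric] sum_divide_distrib[symmetric] sum_char_val_one_line using lam_pos by (metis divide_self less_irrefl of_rat_1)
  have rows: "(\<Sum>\<tau>\<in>Sym n. ?P \<pi> \<tau>) = 1" if "\<pi> \<in> Sym n" for \<pi>
    using sum.reindex_bij_betw[OF bij_betw_compose_inv[OF that],
        of "\<lambda>\<sigma>. of_rat (char_val (one_line n \<sigma>) / lam \<Phi> ^ n) :: real"] sum1 that by (simp add: K_eq)
  \<comment> \<open>For fixed \<tau> the product \<open>\<pi> \<circ> inv \<tau>\<close> runs
    through the whole group, so \<open>K\<close> is doubly stochastic and the uniform distribution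
    is stationary.\<close>
  have cols: "(\<Sum>\<pi>\<in>Sym n. ?P \<pi> \<tau>) = 1" if "\<tau> \<in> Sym n" for \<tau>
  proof -
    have "bij_betw (\<lambda>\<pi>. \<pi> \<circ> inv \<tau>) (Sym n) (Sym n)"
      using that by (intro bij_betw_byWitness[where f' = "\<lambda>\<sigma>. \<sigma> \<circ> \<tau>"])
        (auto simp: comp_assoc Sym_inv_o Sym_compose Sym_inv)
    from sum.reindex_bij_betw[OF this, of "\<lambda>\<sigma>. of_rat (char_val (one_line n \<sigma>) / lam \<Phi> ^ n) :: real"]
    show ?thesis using sum1 that by (simp add: K_eq)
  qed
  have nonneg: "0 \<le> ?P \<pi> \<tau>" if "\<pi> \<in> Sym n" "\<tau> \<in> Sym n" for \<pi> \<tau>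
    using that lam_pos char_val_nonneg[OF Sym_compose[OF that(1) Sym_inv[OF that(2)]]] by (simp add: K_eq)
  have card: "card (Sym n) = fact n" unfolding Sym_def by (rule card_permutations) simp_all
  have stat: "stationary_distribution (Sym n) ?P (\<lambda>\<sigma>. 1 / fact n)"
    using nonneg rows cols card
    by (simp add: stationary_distribution_def stochastic_matrix_def probability_vector_def
        sum_divide_distrib[symmetric])
  have conn: "pred_connected (Sym n) ?P"
    unfolding pred_connected_def
  proof (intro allI impI)
    fix Z assume Z: "Z \<subseteq> Sym n" "Z \<noteq> {}" "\<forall>x\<in>Sym n. \<forall>y\<in>Z. 0 < ?P x y \<longrightarrow> x \<in> Z"
    show "Z = Sym n"
    proof (rule descent_class_generates[OF \<alpha>(1) Z(1,2)])
      fix \<sigma> \<tau> assume *: "\<sigma> \<in> Sym n" "D n \<sigma> = \<alpha>" "\<tau> \<in> Z"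
      then have \<tau>: "\<tau> \<in> Sym n" using Z(1) by blast
      have "(\<sigma> \<circ> \<tau>) \<circ> inv \<tau> = \<sigma>" using Sym_inv_o(2)[OF \<tau>] by (simp add: comp_assoc)
      \<comment> \<open>Thus \<open>\<sigma> \<circ> \<tau>\<close> is a predecessor of \<tau>, the
        transition having probability \<chi>(\<sigma>) divided by the power of
        \<open>lam \<Phi>\<close>. So a predecessor-closed set is closed under left multiplication
        by the class of \<alpha>.\<close>
      then have "0 < ?P (\<sigma> \<circ> \<tau>) \<tau>"
        using K_eq[OF Sym_compose[OF *(1) \<tau>] \<tau>] char_val_pos[OF *(1,2)] lam_pos by simp
      then show "\<sigma> \<circ> \<tau> \<in> Z" using Z(3) *(3) Sym_compose[OF *(1) \<tau>] by blast
    qed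
  qed
  have "unique_stationary_distribution (Sym n) ?P (\<lambda>\<sigma>. 1 / fact n)"
    by (rule unique_stationary_distributionI[OF finite_Sym stat _ conn]) simp
  \<comment> \<open>This is the image of the uniform distribution under \<open>D\<close>; each
    constant fibre sum is the size of the fibre over \<open>fact n\<close>.\<close>
  moreover have "unique_stationary_distribution (Comp n) (K_bar n \<Phi>)
      (\<lambda>\<alpha>. \<Sum>\<sigma> | \<sigma> \<in> Sym n \<and> D n \<sigma> = \<alpha>. 1 / fact n)"
    by (rule unique_stationary_distribution_lumped[OF finite_Sym D_surj stat _ conn])
       (simp_all add: K_bar_eq)
  ultimately show ?thesis by simp
qed

end
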